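(* Let $G\in\{\mathrm{GL}_{2n},\mathrm{SL}_{2n}\}$ over $\mathbb F_q$. Fix a character $\chi\colon P\to\mathbb C^\times$, written as $\chi=(\alpha\circ m)(\beta\circ\chi_{\det})$ with characters $\alpha,\beta\colon\mathbb F_q^\times\to\mathbb C^\times$. Suppose $\beta=1$ (so that $\chi=\chi^J$). Then the operator $I$ on $\operatorname{Ind}_P^G\chi$ is diagonalizable and has eigenvalues given by $$\left\{(-1)^{n-i}q^{\binom n2+\binom{i+1}2}:0\le i\le n\right\}.$$
   Context: $q$ is an odd prime power with $3\nmid q$, and $n\ge1$. $P=\left\{\begin{bmatrix}A&B\\0&D\end{bmatrix}\in G\right\}$ with $n\times n$ blocks, $U=\left\{\begin{bmatrix}1_n&B\\0&1_n\end{bmatrix}:B\in\mathbb F_q^{n\times n}\right\}$, and $J=\begin{bmatrix}0&-1_n\\1_n&0\end{bmatrix}$. $\chi_{\det}\colon P\to\mathbb F_q^\times$ is $\begin{bmatrix}A&B\\0&D\end{bmatrix}\mapsto(\det D)^{-1}$, and $m\colon P\to\mathbb F_q^\times$ is $\begin{bmatrix}A&B\\0&D\end{bmatrix}\mapsto\det(AD)$ (which is trivial for $\mathrm{SL}_{2n}$). (Every character of $P$ has the form $(\alpha\circ m)(\beta\circ\chi_{\det})$.) The character $\chi^J$ is $\chi^J\left(\begin{bmatrix}A&B\\0&D\end{bmatrix}\right)=\chi\left(\begin{bmatrix}D&0\\0&A\end{bmatrix}\right)$. $\operatorname{Ind}_P^G\chi$ is the space of functions $f\colon G\to\mathbb C$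 with $f(pg)=\chi(p)f(g)$ for $p\in P$, $g\in G$. The operator $I\colon\operatorname{Ind}_P^G\chi\to\operatorname{Ind}_P^G\chi^J$ is $(If)(g)=\sum_{u\in U}f(J^{-1}ug)$. *)

theory Defs
  imports "HOL-Analysis.Analysis" "HOL-Library.Function_Algebras"
begin

text \<open>Matrices of size \<open>2n\<close> are indexed by \<open>'n + 'n\<close> with \<open>n = CARD('n)\<close>, so that the
  \<open>n \<times> n\<close> blocks are indexed by the constructors \<open>Inl\<close> and \<open>Inr\<close>.\<close>

definition block_mat ::
  "'a^('n::finite)^('n::finite) \<Rightarrow> 'a^('n::finite)^('n::finite) \<Rightarrow> 'a^('n::finite)^('n::finite) \<Rightarrow> 'a^('n::finite)^('n::finite) \<Rightarrow> 'a^('n::finite + 'n)^('n + 'n)" where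
  "block_mat A B C D = (\<chi> i j. case (i, j) of
      (Inl a, Inl b) \<Rightarrow> A $ a $ b
    | (Inl a, Inr b) \<Rightarrow> B $ a $ b
    | (Inr a, Inl b) \<Rightarrow> C $ a $ b
    | (Inr a, Inr b) \<Rightarrow> D $ a $ b)"

definition upper_left :: "'a^('n::finite + 'n)^('n + 'n) \<Rightarrow> 'a^('n::finite)^('n::finite)" where
  "upper_left g = (\<chi> i j. g $ Inl i $ Inl j)"

definition lower_right :: "'a^('n::finite + 'n)^('n + 'n) \<Rightarrow> 'a^('n::finite)^('n::finite)" where
  "lower_right g = (\<chi> i j. g $ Inr i $ Inr j)"

definition GL :: "('a::field^('m::finite)^('m::finite)) set" where
  "GL = {g. invertible g}"

definition SL :: "('a::field^('m::finite)^('m::finite)) set" where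
  "SL = {g. det g = 1}"

definition parabolic ::
  "('a::field^('n::finite + 'n)^('n + 'n)) set \<Rightarrow> ('a^('n::finite + 'n)^('n + 'n)) set" where
  "parabolic G = {g \<in> G. \<exists>A B D. g = block_mat A B 0 D}"

definition unip :: "('a::field^('n::finite + 'n)^('n + 'n)) set" where
  "unip = range (\<lambda>B. block_mat (mat 1) B 0 (mat 1))"

definition J_mat :: "'a::field^('n::finite + 'n)^('n + 'n)" where
  "J_mat = block_mat 0 (- mat 1) (mat 1) 0"

text \<open>A character of a set \<open>S\<close> that is a group under \<open>mul\<close>; the values outside \<open>S\<close> are
  irrelevant.\<close>

definition is_character :: "'x set \<Rightarrow> ('x \<Rightarrow> 'x \<Rightarrow> 'x) \<Rightarrow> ('x \<Rightarrow> complex) \<Rightarrow> bool" where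
  "is_character S mul chi \<longleftrightarrow>
     (\<forall>x\<in>S. chi x \<noteq> 0) \<and> (\<forall>x\<in>S. \<forall>y\<in>S. chi (mul x y) = chi x * chi y)"

definition chi_det :: "'a::field^('n::finite + 'n)^('n + 'n) \<Rightarrow> 'a" where
  "chi_det p = inverse (det (lower_right p))"

definition m_char :: "'a::field^('n::finite + 'n)^('n + 'n) \<Rightarrow> 'a" where
  "m_char p = det (upper_left p ** lower_right p)"

definition twist_J ::
  "('a::field^('n::finite + 'n)^('n + 'n) \<Rightarrow> complex) \<Rightarrow> 'a^('n::finite + 'n)^('n + 'n) \<Rightarrow> complex" where
  "twist_J chi p = chi (block_mat (lower_right p) 0 0 (upper_left p))"

text \<open>Functions \<open>G \<rightarrow> \<complex>\<close> are represented by functions on all matrices vanishing outside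
  \<open>G\<close>, so that they form a linear subspace.\<close>

definition Ind ::
  "('a::field^('n::finite + 'n)^('n + 'n)) set \<Rightarrow> ('a^('n::finite + 'n)^('n + 'n) \<Rightarrow> complex)
    \<Rightarrow> ('a^('n::finite + 'n)^('n + 'n) \<Rightarrow> complex) set" where
  "Ind G chi = {f. (\<forall>g. g \<notin> G \<longrightarrow> f g = 0) \<and>
                 (\<forall>p\<in>parabolic G. \<forall>g\<in>G. f (p ** g) = chi p * f g)}"

definition intertwiner ::
  "('a::field^('n::finite + 'n)^('n + 'n)) set \<Rightarrow> ('a^('n::finite + 'n)^('n + 'n) \<Rightarrow> complex)
    \<Rightarrow> 'a^('n::finite + 'n)^('n + 'n) \<Rightarrow> complex" where
  "intertwiner G f g = (if g \<in> G then \<Sum>u\<in>unip. f (matrix_inv J_mat ** u ** g) else 0)"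

definition cscale :: "complex \<Rightarrow> ('x \<Rightarrow> complex) \<Rightarrow> 'x \<Rightarrow> complex" where
  "cscale c f = (\<lambda>x. c * f x)"

global_interpretation cfun: vector_space cscale
  by unfold_locales (auto simp: cscale_def fun_eq_iff algebra_simps)

definition linear_operator_on ::
  "('x \<Rightarrow> complex) set \<Rightarrow> (('x \<Rightarrow> complex) \<Rightarrow> 'x \<Rightarrow> complex) \<Rightarrow> bool" where
  "linear_operator_on V T \<longleftrightarrow>
     cfun.subspace V \<and> T ` V \<subseteq> V \<and>
     (\<forall>f\<in>V. \<forall>h\<in>V. T (f + h) = T f + T h) \<and> (\<forall>c. \<forall>f\<in>V. T (cscale c f) = cscale c (T f))"

definition eigenvector_on ::
  "('x \<Rightarrow> complex) set \<Rightarrow> (('x \<Rightarrow> complex) \<Rightarrow> 'x \<Rightarrow> complex) \<Rightarrow> complex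
    \<Rightarrow> ('x \<Rightarrow> complex) \<Rightarrow> bool" where
  "eigenvector_on V T c f \<longleftrightarrow> f \<in> V \<and> f \<noteq> 0 \<and> T f = cscale c f"

definition eigenvalues_on ::
  "('x \<Rightarrow> complex) set \<Rightarrow> (('x \<Rightarrow> complex) \<Rightarrow> 'x \<Rightarrow> complex) \<Rightarrow> complex set" where
  "eigenvalues_on V T = {c. \<exists>f. eigenvector_on V T c f}"

definition diagonalizable_on ::
  "('x \<Rightarrow> complex) set \<Rightarrow> (('x \<Rightarrow> complex) \<Rightarrow> 'x \<Rightarrow> complex) \<Rightarrow> bool" where
  "diagonalizable_on V T \<longleftrightarrow> linear_operator_on V T \<and>
     (\<exists>E. cfun.independent E \<and> cfun.span E = V \<and> (\<forall>f\<in>E. \<exists>c. eigenvector_on V T c f))"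

end

theory Submission
  imports Defs
begin

text \<open>Since \<open>\<beta> = 1\<close>, the character of \<open>P\<close> is \<open>\<alpha> \<circ> det\<close>, so a function in the induced
representation is \<open>\<alpha> \<circ> det\<close> times a function of the coset \<open>P g\<close>. That coset amounts to an
\<open>n\<close>-dimensional subspace \<open>S\<^sub>g\<close> of \<open>F\<^sup>2\<^sup>n\<close>, the row space of the lower half of \<open>g\<close>. When \<open>B\<close> runs
through all matrices, the subspace of \<open>J\<inverse> u\<^sub>B g\<close> runs once through the complements of \<open>S\<^sub>g\<close>.
Up to the twist, \<open>I\<close> is therefore the adjacency operator of the graph on the Grassmannian in which
complementary subspaces are joined.

For a set \<open>X\<close> of vectors let \<open>e\<^sub>X\<close> be the (twisted) indicator of the condition \<open>X \<subseteq> S\<^sub>g\<close>, and let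
\<open>W k\<close> be the span of the \<open>e\<^sub>X\<close> with fewer than \<open>k\<close> elements in \<open>X\<close>. Then \<open>W 0 = {0}\<close>, and
\<open>W (n + 1)\<close> is the whole representation because a subspace of dimension \<open>n\<close> that contains the lower
rows of \<open>g\<close> is \<open>S\<^sub>g\<close> (\<open>filtration_top\<close>). If \<open>X\<close> is independent with \<open>j\<close> elements and span \<open>T\<close>,
then \<open>(I e\<^sub>X)(g)\<close> counts the complements of \<open>S\<^sub>g\<close> that contain \<open>T\<close>. There are \<open>q\<^bsup>n(n-j)\<^esup>\<close> of
them if \<open>T \<inter> S\<^sub>g = 0\<close> and none otherwise (\<open>card_opposite_containing\<close>). The indicator of
\<open>T \<inter> S\<^sub>g = 0\<close> equals \<open>(-1)\<^sup>j q\<^bsup>j(j-1)/2\<^esup> e\<^sub>X\<close> modulo \<open>W j\<close> (\<open>avoiding_leading_term\<close>). So \<open>I\<close>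
acts on \<open>W (j + 1) / W j\<close> as the scalar \<open>(-1)\<^sup>j q\<^bsup>n(n-j) + j(j-1)/2\<^esup>\<close>, and these scalars are
pairwise distinct. It follows that \<open>I\<close> is diagonalizable and that the scalar number \<open>j\<close> is an
eigenvalue if \<open>W j \<noteq> W (j + 1)\<close> (\<open>triangular_filtration_spectrum\<close>).

It remains to see that the filtration is strict. Multiplication by the indicator of \<open>t \<in> S\<^sub>g\<close>
turns \<open>e\<^sub>X\<close> into the function of \<open>insert t X\<close>, so if the filtration stops growing at some point it
never grows again (\<open>filtration_stationary\<close>), and it suffices to have \<open>W n \<noteq> W (n + 1)\<close>. On the
subspaces \<open>{(x, x B)}\<close>, the sum over the matrices \<open>B\<close> of trace \<open>0\<close> minus the sum over those of
trace \<open>1\<close> is a linear functional that vanishes on \<open>W n\<close> (\<open>trace_balanced_on_filtration\<close>), but not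
on the indicator of the single point \<open>B = 0\<close>, which lies in \<open>W (n + 1)\<close>. With \<open>i = n - j\<close> the
scalars are the ones in the theorem.\<close>

section \<open>Determinants of block triangular matrices\<close>

lemma map_sum_permutes:
  fixes p :: "'a \<Rightarrow> 'a" and r :: "'b \<Rightarrow> 'b"
  assumes "p permutes UNIV" "r permutes UNIV"
  shows "map_sum p r permutes UNIV"
proof -
  have "bij p" "bij r" using assms permutes_bij by blast+
  have "inj (map_sum p r)"
  proof (rule injI)
    fix x y assume "map_sum p r x = map_sum p r y"
    then show "x = y"
      using \<open>bij p\<close> \<open>bij r\<close> by (cases x; cases y) (auto simp: bij_def inj_def)
  qed
  moreover have "\<exists>x. map_sum p r x = y" for y
  proof (cases y)
    case (Inl a)
    then obtain x where "p x = a" using \<open>bij p\<close> bij_pointE by metis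
    then show ?thesis using Inl by (intro exI[of _ "Inl x"]) simp
  next
    case (Inr b)
    then obtain x where "r x = b" using \<open>bij r\<close> bij_pointE by metis
    then show ?thesis using Inr by (intro exI[of _ "Inr x"]) simp
  qed
  ultimately show ?thesis by (metis (full_types) injD permutes_univ)
qed

lemma sign_map_sum_id:
  fixes p :: "'a::finite \<Rightarrow> 'a"
  assumes "p permutes UNIV"
  shows "sign (map_sum p id :: 'a + 'b::finite \<Rightarrow> _) = sign p"
    and "sign (map_sum id p :: 'b::finite + 'a \<Rightarrow> _) = sign p"
proof -
  have "sign (map_sum p id :: 'a + 'b \<Rightarrow> _) = sign p
      \<and> sign (map_sum id p :: 'b + 'a \<Rightarrow> _) = sign p"
    using finite[of UNIV] assms
  proof (induction p rule: permutes_rev_induct)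
    case id
    have "map_sum id id = (id :: 'a + 'b \<Rightarrow> _)" "map_sum id id = (id :: 'b + 'a \<Rightarrow> _)"
      by (simp_all only: sum.map_id0)
    then show ?case by (simp only: sign_id)
  next
    case (swap a b p)
    have l: "map_sum (p \<circ> Transposition.transpose a b) id
        = (map_sum p id :: 'a + 'b \<Rightarrow> _) \<circ> Transposition.transpose (Inl a) (Inl b)" (is "?l1 = ?l2")
    proof
      fix x :: "'a + 'b" show "?l1 x = ?l2 x"
        by (cases x) (auto simp: Transposition.transpose_def)
    qed
    have r: "map_sum id (p \<circ> Transposition.transpose a b)
        = (map_sum id p :: 'b + 'a \<Rightarrow> _) \<circ> Transposition.transpose (Inr a) (Inr b)" (is "?r1 = ?r2")
    proof
      fix x :: "'b + 'a" show "?r1 x = ?r2 x"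
        by (cases x) (auto simp: Transposition.transpose_def)
    qed
    have pU: "p permutes UNIV" using swap.hyps by blast
    then have pl: "permutation (map_sum p id :: 'a + 'b \<Rightarrow> _)"
      and pr: "permutation (map_sum id p :: 'b + 'a \<Rightarrow> _)"
      and pp: "permutation p"
      using pU map_sum_permutes[OF pU permutes_id]
        map_sum_permutes[OF permutes_id pU]
      by (auto simp: permutation_permutes intro: finite)
    show ?case
      unfolding l r sign_compose[OF pl permutation_swap_id] sign_compose[OF pr permutation_swap_id]
        sign_compose[OF pp permutation_swap_id]
      using swap.IH by (simp only: sign_swap_id sum.inject simp_thms)
  qed
  then show "sign (map_sum p id :: 'a + 'b \<Rightarrow> _) = sign p"
    and "sign (map_sum id p :: 'b + 'a \<Rightarrow> _) = sign p" by auto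
qed

lemma sign_map_sum:
  fixes p :: "'a::finite \<Rightarrow> 'a" and r :: "'b::finite \<Rightarrow> 'b"
  assumes "p permutes UNIV" "r permutes UNIV"
  shows "sign (map_sum p r) = sign p * sign r"
proof -
  have "map_sum p r = map_sum p id \<circ> map_sum id r"
    by (simp add: map_sum.comp)
  moreover have "permutation (map_sum p (id :: 'b \<Rightarrow> _))" "permutation (map_sum (id :: 'a \<Rightarrow> _) r)"
    using map_sum_permutes[OF assms(1) permutes_id] map_sum_permutes[OF permutes_id assms(2)]
    by (auto simp: permutation_permutes intro: finite)
  ultimately show ?thesis
    using assms by (simp add: sign_compose sign_map_sum_id)
qed

text \<open>An injective self-map of a finite set that maps the right summand into itself maps it onto itself,
so it has to preserve the left summand as well.\<close>

lemma permutation_preserving_Inr: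
  fixes p :: "'a::finite + 'b::finite \<Rightarrow> 'a + 'b"
  assumes "p permutes UNIV" and "\<And>j. \<exists>k. p (Inr j) = Inr k"
  obtains p1 p2 where "p1 permutes UNIV" "p2 permutes UNIV" "p = map_sum p1 p2"
proof -
  obtain p2 where p2: "\<And>j. p (Inr j) = Inr (p2 j)" using assms(2) by metis
  have inj: "inj p" using assms(1) permutes_inj by blast
  have "inj p2"
    using inj p2 by (metis injD injI sum.inject(2))
  then have "bij p2" by (simp add: bij_def finite_UNIV_inj_surj)
  have "\<exists>k. p (Inl i) = Inl k" for i
  proof (cases "p (Inl i)")
    case (Inr m)
    then obtain j where "p2 j = m" using \<open>bij p2\<close> by (metis bij_pointE)
    then have "p (Inl i) = p (Inr j)" using p2 Inr by simp
    then show ?thesis using inj by (metis injD sum.distinct(1))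
  qed auto
  then obtain p1 where p1: "\<And>i. p (Inl i) = Inl (p1 i)" by metis
  have "inj p1"
    using inj p1 by (metis injD injI sum.inject(1))
  then have "bij p1" by (simp add: bij_def finite_UNIV_inj_surj)
  moreover have "p = map_sum p1 p2"
    proof
    fix x show "p x = map_sum p1 p2 x" using p1 p2 by (cases x) auto
  qed
  ultimately show ?thesis
    using that \<open>bij p2\<close> by (simp add: permutes_univ bij_iff)
qed

lemma prod_sum_type:
  fixes f :: "'a::finite + 'b::finite \<Rightarrow> 'c::comm_monoid_mult"
  shows "(\<Prod>i\<in>UNIV. f i) = (\<Prod>i\<in>UNIV. f (Inl i)) * (\<Prod>i\<in>UNIV. f (Inr i))"
  by (simp add: UNIV_Plus_UNIV[symmetric] prod.Plus del: UNIV_Plus_UNIV)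

lemma sum_sum_type:
  fixes f :: "'a::finite + 'b::finite \<Rightarrow> 'c::comm_monoid_add"
  shows "(\<Sum>i\<in>UNIV. f i) = (\<Sum>i\<in>UNIV. f (Inl i)) + (\<Sum>i\<in>UNIV. f (Inr i))"
  by (simp add: UNIV_Plus_UNIV[symmetric] sum.Plus del: UNIV_Plus_UNIV)

lemma block_mat_nth [simp]:
  "block_mat A B C D $ Inl a $ Inl b = A $ a $ b"
  "block_mat A B C D $ Inl a $ Inr b = B $ a $ b"
  "block_mat A B C D $ Inr a $ Inl b = C $ a $ b"
  "block_mat A B C D $ Inr a $ Inr b = D $ a $ b"
  by (simp_all add: block_mat_def)

text \<open>In the Leibniz formula a permutation that sends some right index to a left index picks an entry of
the zero block. The remaining permutations are the pairs of permutations of the two halves.\<close>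

lemma det_block_triangular:
  fixes A B D :: "'a::comm_ring_1^'n::finite^'n"
  shows "det (block_mat A B 0 D) = det A * det D"
proof -
  let ?M = "block_mat A B 0 D"
  let ?P = "{p :: 'n \<Rightarrow> 'n. p permutes UNIV}"
  let ?Q = "(\<lambda>(p, r). map_sum p r) ` (?P \<times> ?P)"
  let ?f = "\<lambda>p. of_int (sign p) * (\<Prod>i\<in>UNIV. ?M $ i $ p i)"
  have inj: "inj_on (\<lambda>(p, r). map_sum p r :: 'n + 'n \<Rightarrow> _) (?P \<times> ?P)"
  proof (rule inj_onI, clarify)
    fix p r p' r' :: "'n \<Rightarrow> 'n"
    assume "map_sum p r = map_sum p' r'"
    then have "map_sum p r x = map_sum p' r' x" for x by simp
    from this[of "Inl _"] this[of "Inr _"] show "p = p' \<and> r = r'" by (auto simp: fun_eq_iff)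
  qed
  have "det ?M = sum ?f {p. p permutes UNIV}" by (simp add: det_def)
  also have "\<dots> = sum ?f ?Q"
  proof (rule sum.mono_neutral_right)
    show "finite {p :: 'n + 'n \<Rightarrow> 'n + 'n. p permutes UNIV}" by (simp add: finite_permutations)
    show "?Q \<subseteq> {p. p permutes UNIV}" using map_sum_permutes by auto
    show "\<forall>p\<in>{p. p permutes UNIV} - ?Q. ?f p = 0"
    proof
      fix p :: "'n + 'n \<Rightarrow> 'n + 'n" assume p: "p \<in> {p. p permutes UNIV} - ?Q"
      then obtain j where "\<And>k. p (Inr j) \<noteq> Inr k"
        using permutation_preserving_Inr[of p] by (auto simp: image_iff) metis
      then obtain k where "p (Inr j) = Inl k" by (metis obj_sumE)
      then have "?M $ Inr j $ p (Inr j) = 0" by simp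
      then have "(\<Prod>i\<in>UNIV. ?M $ i $ p i) = 0" by (intro prod_zero) auto
      then show "?f p = 0" by simp
    qed
  qed
  also have "\<dots> = (\<Sum>(p, r)\<in>?P \<times> ?P. ?f (map_sum p r))"
    by (subst sum.reindex[OF inj]) (auto intro!: sum.cong)
  also have "\<dots> = (\<Sum>(p, r)\<in>?P \<times> ?P. (of_int (sign p) * (\<Prod>i\<in>UNIV. A $ i $ p i))
      * (of_int (sign r) * (\<Prod>i\<in>UNIV. D $ i $ r i)))"
    by (rule sum.cong) (auto simp: sign_map_sum prod_sum_type)
  also have "\<dots> = det A * det D"
    by (simp add: det_def sum_product sum.cartesian_product)
  finally show ?thesis .
qed

lemma block_mat_mult:
  fixes A B C D :: "'a::comm_ring_1^'n::finite^'n"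
  shows "block_mat A B C D ** block_mat A' B' C' D'
    = block_mat (A ** A' + B ** C') (A ** B' + B ** D') (C ** A' + D ** C') (C ** B' + D ** D')"
proof -
  have "(block_mat A B C D ** block_mat A' B' C' D') $ i $ j
    = block_mat (A ** A' + B ** C') (A ** B' + B ** D') (C ** A' + D ** C') (C ** B' + D ** D')
      $ i $ j" for i j
    by (cases i; cases j) (simp_all add: matrix_matrix_mult_def sum_sum_type)
  then show ?thesis by (simp add: vec_eq_iff)
qed

lemma transpose_block_mat:
  "transpose (block_mat A B C D) = block_mat (transpose A) (transpose C) (transpose B) (transpose D)"
proof -
  have "transpose (block_mat A B C D) $ i $ j
    = block_mat (transpose A) (transpose C) (transpose B) (transpose D) $ i $ j" for i j
    by (cases i; cases j) (simp_all add: Finite_Cartesian_Product.transpose_def)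
  then show ?thesis by (simp add: vec_eq_iff)
qed

lemma mat_1_block:
  "(mat 1 :: 'a::comm_ring_1^('n::finite+'n)^('n+'n)) = block_mat (mat 1) 0 0 (mat 1)"
proof -
  have "(mat 1 :: 'a^('n+'n)^('n+'n)) $ i $ j
    = block_mat (mat 1) 0 0 (mat 1) $ i $ j" for i j
    by (cases i; cases j) (simp_all add: mat_def)
  then show ?thesis by (simp add: vec_eq_iff)
qed

lemma minus_matrix_mult:
  fixes A :: "'a::comm_ring_1^'n::finite^'m::finite" and B :: "'a^'k::finite^'n"
  shows "(- A) ** B = - (A ** B)" "A ** (- B) = - (A ** B)"
  by (simp_all add: matrix_matrix_mult_def vec_eq_iff sum_negf)

text \<open>\<open>J\<close> is a product of three unipotent block triangular matrices.\<close>

lemma det_J_mat: "det (J_mat :: 'a::field^('n::finite+'n)^('n+'n)) = 1"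
proof -
  let ?u = "block_mat (mat 1) (- mat 1) 0 (mat 1) :: 'a^('n+'n)^('n+'n)"
  let ?l = "block_mat (mat 1) 0 (mat 1) (mat 1) :: 'a^('n+'n)^('n+'n)"
  have l: "?l = transpose (block_mat (mat 1) (mat 1) 0 (mat 1))"
    by (simp add: transpose_block_mat) (simp add: Finite_Cartesian_Product.transpose_def zero_vec_def)
  \<comment> \<open>the decomposition of the Weyl element of \<open>SL\<^sub>2\<close>, with blocks as entries\<close>
  have "?u ** ?l ** ?u = J_mat"
    by (simp add: block_mat_mult J_mat_def minus_matrix_mult)
  then have "det ?u * det ?l * det ?u = det (J_mat :: 'a^('n+'n)^('n+'n))"
    by (metis det_mul)
  then show ?thesis by (simp add: l det_block_triangular)
qed

lemma matrix_inv_mult: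
  fixes g :: "'a::field^'m::finite^'m"
  assumes "invertible g"
  shows "g ** matrix_inv g = mat 1" "matrix_inv g ** g = mat 1"
proof -
  from assms have "\<exists>h. g ** h = mat 1 \<and> h ** g = mat 1" by (simp add: invertible_def)
  from someI_ex[OF this] show "g ** matrix_inv g = mat 1" "matrix_inv g ** g = mat 1"
    by (simp_all add: matrix_inv_def)
qed

lemma matrix_inv_J_mat:
  "matrix_inv J_mat = (block_mat 0 (mat 1) (- mat 1) 0 :: 'a::field^('n::finite+'n)^('n+'n))"
proof -
  let ?K = "block_mat 0 (mat 1) (- mat 1) 0 :: 'a^('n+'n)^('n+'n)"
  have KJ: "?K ** J_mat = mat 1" "J_mat ** ?K = mat 1"
    by (simp_all add: J_mat_def block_mat_mult mat_1_block minus_matrix_mult)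
  then have "J_mat ** matrix_inv J_mat = (mat 1 :: 'a^('n+'n)^('n+'n))"
    using matrix_inv_mult(1) unfolding invertible_def by blast
  then have "(?K ** J_mat) ** matrix_inv J_mat = ?K"
    by (simp add: matrix_mul_assoc[symmetric])
  then show ?thesis using KJ by simp
qed

section \<open>Lower row spaces\<close>

text \<open>The translates \<open>J\<inverse> u\<^sub>B\<close> in the definition of the intertwining operator.\<close>

definition opposite :: "'a::field^'n::finite^'n \<Rightarrow> 'a^('n + 'n)^('n + 'n)" where
  "opposite B = matrix_inv J_mat ** block_mat (mat 1) B 0 (mat 1)"

lemma det_opposite: "det (opposite B) = 1"
proof -
  have "det (J_mat ** matrix_inv J_mat :: 'a::field^('n::finite + 'n)^('n + 'n)) = 1"
    by (subst matrix_inv_mult(1)) (simp_all add: invertible_det_nz det_J_mat)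
  then have "det (matrix_inv J_mat :: 'a::field^('n::finite + 'n)^('n + 'n)) = 1"
    by (simp add: det_mul det_J_mat)
  then show ?thesis by (simp add: opposite_def det_mul det_block_triangular)
qed

definition lower_vectors :: "('a::field^('n::finite + 'n)) set" where
  "lower_vectors = {z. \<forall>i. z $ Inl i = 0}"

text \<open>The point of the Grassmannian that corresponds to the coset \<open>P g\<close>. Vectors are rows, so that \<open>G\<close>
acts from the right.\<close>

definition lower_row_space :: "'a::field^('n::finite + 'n)^('n + 'n) \<Rightarrow> ('a^('n + 'n)) set" where
  "lower_row_space g = (\<lambda>z. z v* g) ` lower_vectors"

definition first_half :: "'a^('n::finite + 'n) \<Rightarrow> 'a^'n" where
  "first_half t = (\<chi> i. t $ Inl i)"

definition second_half :: "'a^('n::finite + 'n) \<Rightarrow> 'a^'n" where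
  "second_half t = (\<chi> i. t $ Inr i)"

lemma linear_vector_matrix_mult:
  fixes g :: "'a::field^'m::finite^'k::finite"
  shows "Vector_Spaces.linear (*s) (*s) (\<lambda>z. z v* g)"
proof -
  have "(\<lambda>z. z v* g) = (\<lambda>z. Finite_Cartesian_Product.transpose g *v z)" by simp
  then show ?thesis by (simp only: matrix_vector_mul_linear_gen)
qed

lemma linear_first_half: "Vector_Spaces.linear (*s) (*s) (first_half :: 'a::field^('n::finite + 'n) \<Rightarrow> _)"
  by (simp add: Vector_Spaces.linear_iff vec.vector_space_axioms first_half_def vec_eq_iff)

lemma subspace_lower_vectors: "vec.subspace (lower_vectors :: ('a::field^('n::finite + 'n)) set)"
  by (simp add: vec.subspace_def lower_vectors_def)

lemma subspace_lower_row_space: "vec.subspace (lower_row_space g)"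
  unfolding lower_row_space_def
  by (rule vec.linear_subspace_image[OF linear_vector_matrix_mult subspace_lower_vectors])

lemma lower_row_space_mult: "lower_row_space (h ** g) = (\<lambda>z. z v* g) ` lower_row_space h"
  by (simp add: lower_row_space_def image_image vector_matrix_mul_assoc)

lemma vector_matrix_mult_cancel:
  fixes g :: "'a::field^'m::finite^'m"
  assumes "invertible g"
  shows "x v* g v* matrix_inv g = x" "x v* matrix_inv g v* g = x"
  by (simp_all add: vector_matrix_mul_assoc matrix_inv_mult[OF assms] vector_matrix_mul_rid)

lemma inj_vector_matrix_mult:
  fixes g :: "'a::field^'m::finite^'m"
  assumes "invertible g"
  shows "inj (\<lambda>z. z v* g)"
  by (rule inj_on_inverseI[where g = "\<lambda>z. z v* matrix_inv g"]) (rule vector_matrix_mult_cancel(1)[OF assms])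

lemma card_lower_row_space:
  fixes g :: "'a::{field,finite}^('n::finite + 'n)^('n + 'n)"
  assumes "invertible g"
  shows "card (lower_row_space g) = card (lower_vectors :: ('a^('n + 'n)) set)"
  unfolding lower_row_space_def
  by (rule card_image) (rule inj_on_subset[OF inj_vector_matrix_mult[OF assms] subset_UNIV])

lemma vector_block_mat:
  fixes z :: "'a::field^('n::finite + 'n)"
  shows "(z v* block_mat A B C D) $ Inl j = (first_half z v* A + second_half z v* C) $ j"
    and "(z v* block_mat A B C D) $ Inr j = (first_half z v* B + second_half z v* D) $ j"
  by (simp_all add: vector_matrix_mult_def first_half_def second_half_def sum_sum_type)

lemma lower_row_space_block_triangular_mult:
  fixes p g :: "'a::{field,finite}^('n::finite + 'n)^('n + 'n)"
  assumes "invertible p" "p = block_mat A B 0 D"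
  shows "lower_row_space (p ** g) = lower_row_space g"
proof -
  have "z v* p \<in> lower_vectors" if "z \<in> lower_vectors" for z
  proof -
    have "first_half z = 0" using that by (simp add: lower_vectors_def first_half_def vec_eq_iff)
    then show ?thesis by (simp add: lower_vectors_def assms(2) vector_block_mat)
  qed
  then have "lower_row_space p \<subseteq> lower_vectors" by (auto simp: lower_row_space_def)
  then have "lower_row_space p = lower_vectors"
    using card_lower_row_space[OF assms(1)] by (intro card_subset_eq) simp_all
  then show ?thesis unfolding lower_row_space_mult by (simp add: lower_row_space_def)
qed

lemma lower_row_space_eqD:
  fixes g h :: "'a::field^('n::finite + 'n)^('n + 'n)"
  assumes "invertible g" "lower_row_space h = lower_row_space g"
  obtains A B D where "h ** matrix_inv g = block_mat A B 0 D"
proof -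
  define p where "p = h ** matrix_inv g"
  have "z v* p \<in> lower_vectors" if "z \<in> lower_vectors" for z
  proof -
    have "z v* h \<in> lower_row_space g" using that assms(2) by (auto simp: lower_row_space_def)
    then obtain y where "y \<in> lower_vectors" "z v* h = y v* g" by (auto simp: lower_row_space_def)
    then show ?thesis
      using vector_matrix_mult_cancel(1)[OF assms(1), of y]
      by (simp add: p_def vector_matrix_mul_assoc[symmetric])
  qed
  note p = this
  have "p $ Inr i $ Inl j = 0" for i j
  proof -
    have "axis (Inr i) 1 \<in> (lower_vectors :: ('a^('n + 'n)) set)"
      by (simp add: lower_vectors_def axis_def)
    from p[OF this] have "(axis (Inr i) 1 v* p) $ Inl j = 0" by (simp add: lower_vectors_def)
    then show ?thesis
      by (simp add: vector_matrix_mult_def axis_def if_distrib[of "\<lambda>x. x * _"] cong: if_cong)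
  qed
  then have "p $ a $ b = block_mat (\<chi> i j. p $ Inl i $ Inl j) (\<chi> i j. p $ Inl i $ Inr j) 0
      (\<chi> i j. p $ Inr i $ Inr j) $ a $ b" for a b
    by (cases a; cases b) simp_all
  then have "p = block_mat (\<chi> i j. p $ Inl i $ Inl j) (\<chi> i j. p $ Inl i $ Inr j) 0
      (\<chi> i j. p $ Inr i $ Inr j)"
    unfolding vec_eq_iff by (intro allI)
  then show thesis using that unfolding p_def by blast
qed

text \<open>Both row spaces have the same number of elements, so an inclusion between them is an equality. This
expresses the indicator of one point of the Grassmannian through \<open>n\<close> membership conditions.\<close>

lemma lower_rows_subset_lower_row_space_iff:
  fixes g h :: "'a::{field,finite}^('n::finite + 'n)^('n + 'n)"
  assumes "invertible g" "invertible h"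
  shows "range (\<lambda>i. g $ Inr i) \<subseteq> lower_row_space h \<longleftrightarrow> lower_row_space g = lower_row_space h"
proof
  have row: "g $ Inr i = axis (Inr i) 1 v* g" for i
    by (simp add: vec_eq_iff vector_matrix_mult_def axis_def if_distrib[of "\<lambda>x. x * _"] cong: if_cong)
  have "axis (Inr i) 1 \<in> (lower_vectors :: ('a^('n + 'n)) set)" for i
    by (simp add: lower_vectors_def axis_def)
  then have "range (\<lambda>i. g $ Inr i) \<subseteq> lower_row_space g"
    unfolding lower_row_space_def row by blast
  then show "lower_row_space g = lower_row_space h \<Longrightarrow> range (\<lambda>i. g $ Inr i) \<subseteq> lower_row_space h" by simp
  assume sub: "range (\<lambda>i. g $ Inr i) \<subseteq> lower_row_space h"
  have "z v* g \<in> lower_row_space h" if "z \<in> lower_vectors" for z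
  proof -
    have "z v* g = (\<Sum>i\<in>UNIV. z $ Inr i *s g $ Inr i)"
      using that by (simp add: vec_eq_iff vector_matrix_mult_def sum_sum_type lower_vectors_def)
    also have "\<dots> \<in> lower_row_space h"
      using sub by (intro vec.subspace_sum[OF subspace_lower_row_space] vec.subspace_scale[OF subspace_lower_row_space]) auto
    finally show ?thesis .
  qed
  then have "lower_row_space g \<subseteq> lower_row_space h" by (auto simp: lower_row_space_def)
  then show "lower_row_space g = lower_row_space h"
    by (intro card_subset_eq) (simp_all add: card_lower_row_space[OF assms(1)] card_lower_row_space[OF assms(2)])
qed

text \<open>The lower half of \<open>J\<inverse> u\<^sub>B\<close> is \<open>(-1, -B)\<close>, so its row space is the graph of \<open>x \<mapsto> x B\<close>. These
graphs are the complements of the space of vectors with vanishing first half.\<close>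

lemma lower_row_space_opposite:
  fixes B :: "'a::field^'n::finite^'n"
  shows "t \<in> lower_row_space (opposite B)
    \<longleftrightarrow> second_half t = first_half t v* B"
proof -
  have m: "opposite B = block_mat 0 (mat 1) (- mat 1) (- B)"
    by (simp add: opposite_def matrix_inv_J_mat block_mat_mult minus_matrix_mult)
  have neg: "y v* (- C) = - (y v* C)" for y :: "'a^'n" and C :: "'a^'n^'n"
    by (simp add: vector_matrix_mult_def vec_eq_iff sum_negf)
  have im: "first_half (z v* block_mat 0 (mat 1) (- mat 1) (- B)) = - second_half z"
    "second_half (z v* block_mat 0 (mat 1) (- mat 1) (- B)) = - (second_half z v* B)"
    if "z \<in> lower_vectors" for z
  proof -
    have "first_half z = 0" using that by (simp add: lower_vectors_def first_half_def vec_eq_iff)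
    then show "first_half (z v* block_mat 0 (mat 1) (- mat 1) (- B)) = - second_half z"
      "second_half (z v* block_mat 0 (mat 1) (- mat 1) (- B)) = - (second_half z v* B)"
      unfolding first_half_def[of "z v* _"] second_half_def[of "z v* _"] vector_block_mat
      by (simp_all add: neg vector_matrix_mul_rid vec_eq_iff)
  qed
  have neg1: "(- y) v* C = - (y v* C)" for y :: "'a^'n" and C :: "'a^'n^'n"
    by (simp add: vector_matrix_mult_def vec_eq_iff sum_negf)
  show ?thesis
  proof
    assume "t \<in> lower_row_space (opposite B)"
    then show "second_half t = first_half t v* B"
      unfolding m lower_row_space_def by (auto simp: im neg1)
  next
    assume t: "second_half t = first_half t v* B"
    \<comment> \<open>the coefficients with respect to the lower rows \<open>(-1, -B)\<close>\<close>
    define z :: "'a^('n + 'n)" where "z = (\<chi> i. case i of Inl a \<Rightarrow> 0 | Inr b \<Rightarrow> - (t $ Inl b))"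
    have z: "z \<in> lower_vectors" and sz: "second_half z = - first_half t"
      by (simp_all add: z_def lower_vectors_def second_half_def first_half_def vec_eq_iff)
    let ?y = "z v* block_mat 0 (mat 1) (- mat 1) (- B)"
    have "first_half ?y = first_half t" "second_half ?y = second_half t"
      using im[OF z] t by (simp_all add: sz neg1)
    then have "?y $ i = t $ i" for i
      by (cases i) (auto simp: first_half_def second_half_def vec_eq_iff)
    then have "t = ?y" by (simp add: vec_eq_iff)
    then show "t \<in> lower_row_space (opposite B)"
      unfolding m lower_row_space_def using z by blast
  qed
qed

lemma linear_map_is_vector_matrix_mult:
  fixes f :: "'a::field^'n::finite \<Rightarrow> 'a^'m::finite"
  assumes "Vector_Spaces.linear (*s) (*s) f"
  shows "x v* Finite_Cartesian_Product.transpose (matrix f) = f x"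
  by (simp only: vector_transpose_matrix matrix_works[OF assms])

section \<open>Counting complements of a subspace\<close>

text \<open>Extend \<open>X\<close> to a basis. A matrix is determined by arbitrary values on the basis, of which those on
\<open>X\<close> are prescribed.\<close>

lemma card_linear_extensions:
  fixes X :: "('a::{field,finite}^'n::finite) set" and f :: "'a^'n \<Rightarrow> 'a^'m::finite"
  assumes X: "vec.independent X"
  shows "card {B :: 'a^'m^'n. \<forall>x\<in>X. x v* B = f x}
    = (CARD('a) ^ CARD('m)) ^ (CARD('n) - card X)"
proof -
  obtain Y where Y: "X \<subseteq> Y" "vec.independent Y" "UNIV \<subseteq> vec.span Y"
    by (rule vec.maximal_independent_subset_extend[OF subset_UNIV X])
  have cY: "card Y = CARD('n)"
    using vec.basis_card_eq_dim[OF subset_UNIV Y(3,2)] by (simp add: card_cart_basis)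
  let ?S = "{B :: 'a^'m^'n. \<forall>x\<in>X. x v* B = f x}"
  let ?r = "\<lambda>B :: 'a^'m^'n. restrict (\<lambda>y. y v* B) (Y - X)"
  have "bij_betw ?r ?S ((Y - X) \<rightarrow>\<^sub>E UNIV)"
  proof (rule bij_betw_imageI)
    show "inj_on ?r ?S"
    proof (rule inj_onI)
      fix B C assume B: "B \<in> ?S" and C: "C \<in> ?S" and eq: "?r B = ?r C"
      have on_Y: "y v* B = y v* C" if "y \<in> Y" for y
      proof (cases "y \<in> X")
        case False
        then show ?thesis using fun_cong[OF eq, of y] that by simp
      qed (use B C in auto)
      have "x v* B = x v* C" for x
        by (rule vec.linear_eq_on[OF linear_vector_matrix_mult linear_vector_matrix_mult _ on_Y,
              of x Y]) (use Y(3) in auto)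
      then have "axis i 1 v* B = axis i 1 v* C" for i by simp
      then show "B = C"
        by (simp add: vec_eq_iff vector_matrix_mult_def axis_def if_distrib[of "\<lambda>x. x * _"] cong: if_cong)
    qed
    show "?r ` ?S = (Y - X) \<rightarrow>\<^sub>E UNIV"
    proof
      show "?r ` ?S \<subseteq> (Y - X) \<rightarrow>\<^sub>E UNIV"
        by (intro image_subsetI restrict_PiE_iff[THEN iffD2] ballI UNIV_I)
      show "(Y - X) \<rightarrow>\<^sub>E UNIV \<subseteq> ?r ` ?S"
      proof
        fix h :: "'a^'n \<Rightarrow> 'a^'m" assume h: "h \<in> (Y - X) \<rightarrow>\<^sub>E UNIV"
        obtain l where l: "Vector_Spaces.linear (*s) (*s) l"
          "\<forall>y\<in>Y. l y = (if y \<in> X then f y else h y)"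
          using vec.linear_independent_extend[OF Y(2), of "\<lambda>y. if y \<in> X then f y else h y"] by blast
        let ?B = "Finite_Cartesian_Product.transpose (matrix l)"
        have B: "x v* ?B = l x" for x by (rule linear_map_is_vector_matrix_mult[OF l(1)])
        have "?B \<in> ?S" using B l(2) Y(1) by auto
        moreover have "h = ?r ?B"
        proof
          fix y
          show "h y = ?r ?B y"
          proof (cases "y \<in> Y - X")
            case True
            then have "h y = l y" using l(2) by auto
            then show ?thesis by (simp only: restrict_apply True B if_True)
          next
            case False
            then show ?thesis by (simp only: restrict_apply if_False PiE_arb[OF h False])
          qed
        qed
        ultimately show "h \<in> ?r ` ?S" by blast
      qed
    qed
  qed
  then have "card ?S = card ((Y - X) \<rightarrow>\<^sub>E (UNIV :: ('a^'m) set))" by (rule bij_betw_same_card)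
  also have "\<dots> = CARD('a^'m) ^ card (Y - X)" by (simp add: card_PiE)
  also have "card (Y - X) = CARD('n) - card X"
    using cY Y(1) by (simp add: card_Diff_subset)
  finally show ?thesis by simp
qed

text \<open>If the span of \<open>X\<close> meets the vectors with vanishing first half trivially, the projection to the first
half is injective on it, and \<open>B\<close> has to be a linear extension of a map given on the projection of
\<open>X\<close>. Otherwise no graph contains \<open>X\<close>.\<close>

lemma card_graphs_containing:
  fixes X :: "('a::{field,finite}^('n::finite + 'n)) set"
  assumes X: "vec.independent X"
  shows "card {B. \<forall>t\<in>X. second_half t = first_half t v* B}
    = (if vec.span X \<inter> lower_vectors \<subseteq> {0} then CARD('a) ^ (CARD('n) * (CARD('n) - card X)) else 0)"
proof (cases "vec.span X \<inter> (lower_vectors :: ('a^('n + 'n)) set) \<subseteq> {0}")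
  case True
  have "inj_on (first_half :: 'a^('n + 'n) \<Rightarrow> _) (vec.span X)"
  proof (rule inj_onI)
    fix s t :: "'a^('n + 'n)" assume st: "s \<in> vec.span X" "t \<in> vec.span X" "first_half s = first_half t"
    then have "s - t \<in> vec.span X \<inter> lower_vectors"
      by (auto simp: vec.span_diff lower_vectors_def first_half_def vec_eq_iff)
    then show "s = t" using True by auto
  qed
  then have inj: "inj_on (first_half :: 'a^('n + 'n) \<Rightarrow> _) X"
    and ind: "vec.independent (first_half ` X)"
    using vec.linear_independent_injective_image[OF linear_first_half X]
    by (auto intro: inj_on_subset[OF _ vec.span_superset])
  \<comment> \<open>membership of \<open>X\<close> prescribes the linear map on the projected vectors\<close>
  let ?f = "\<lambda>x. second_half (inv_into X first_half x)"
  have "{B. \<forall>t\<in>X. second_half t = first_half t v* B}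
    = {B. \<forall>x\<in>first_half ` X. x v* B = ?f x}"
    using inj by auto
  then have "card {B. \<forall>t\<in>X. second_half t = first_half t v* B}
    = (CARD('a) ^ CARD('n)) ^ (CARD('n) - card (first_half ` X))"
    using card_linear_extensions[OF ind, of ?f] by simp
  then show ?thesis using True by (simp add: card_image[OF inj] power_mult)
next
  case False
  then obtain s where s: "s \<in> vec.span X" "s \<in> lower_vectors" "s \<noteq> 0" by auto
  have "\<not> (\<forall>t\<in>X. second_half t = first_half t v* B)" for B
  proof
    assume "\<forall>t\<in>X. second_half t = first_half t v* B"
    then have "X \<subseteq> lower_row_space (opposite B)"
      unfolding lower_row_space_opposite subset_iff by blast
    then have "s \<in> lower_row_space (opposite B)"
      using s(1) vec.span_minimal[OF _ subspace_lower_row_space] by blast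
    then have "second_half s = first_half s v* B" by (simp add: lower_row_space_opposite)
    moreover have "first_half s = 0" using s(2) by (simp add: lower_vectors_def first_half_def vec_eq_iff)
    ultimately have "second_half s = 0" "first_half s = 0" by simp_all
    then have "s $ i = 0" for i
      by (cases i) (auto simp: first_half_def second_half_def vec_eq_iff)
    then show False using s(3) by (simp add: vec_eq_iff)
  qed
  then show ?thesis using False by simp
qed

text \<open>Translation by \<open>g\<close> carries the graphs to the complements of the row space of \<open>g\<close>.\<close>

lemma card_opposite_containing:
  fixes X :: "('a::{field,finite}^('n::finite + 'n)) set"
  assumes X: "vec.independent X" and g: "invertible g"
  shows "card {B. X \<subseteq> lower_row_space (opposite B ** g)}
    = (if vec.span X \<inter> lower_row_space g \<subseteq> {0} then CARD('a) ^ (CARD('n) * (CARD('n) - card X)) else 0)"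
proof -
  let ?h = "\<lambda>t. t v* matrix_inv g"
  let ?Y = "?h ` X"
  have lin: "Vector_Spaces.linear (*s) (*s) ?h" by (rule linear_vector_matrix_mult)
  have inj: "inj ?h"
    by (rule inj_on_inverseI[where g = "\<lambda>z. z v* g"]) (rule vector_matrix_mult_cancel(2)[OF g])
  have Y: "vec.independent ?Y"
    using vec.linear_independent_injective_image[OF lin X] inj inj_on_subset by blast
  have cY: "card ?Y = card X" using inj by (simp add: card_image inj_on_subset)
  have mem: "t \<in> (\<lambda>z. z v* g) ` S \<longleftrightarrow> ?h t \<in> S" for t S
    using vector_matrix_mult_cancel[OF g] by (auto simp: image_iff) metis
  have "{B. X \<subseteq> lower_row_space (opposite B ** g)}
    = {B. \<forall>t\<in>?Y. second_half t = first_half t v* B}"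
    unfolding lower_row_space_mult[of _ g] subset_iff mem lower_row_space_opposite by auto
  moreover have "vec.span ?Y \<inter> lower_vectors \<subseteq> {0} \<longleftrightarrow> vec.span X \<inter> lower_row_space g \<subseteq> {0}"
  proof -
    have "vec.span ?Y = ?h ` vec.span X" by (rule vec.linear_span_image[OF lin])
    moreover have "?h t = 0 \<longleftrightarrow> t = 0" for t
      using injD[OF inj, of t 0] by auto
    moreover have "t \<in> lower_row_space g \<longleftrightarrow> ?h t \<in> lower_vectors" for t
      unfolding lower_row_space_def by (rule mem)
    ultimately show ?thesis by auto
  qed
  ultimately show ?thesis using card_graphs_containing[OF Y] by (simp add: cY)
qed

lemma card_span_independent:
  fixes X :: "('a::{field,finite}^'m::finite) set"
  assumes "vec.independent X"
  shows "card (vec.span X) = CARD('a) ^ card X"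
proof -
  have "finite X" by simp
  then show ?thesis using assms
  proof (induction X)
    case empty
    then show ?case by simp
  next
    case (insert a X)
    have a: "a \<notin> vec.span X" and X: "vec.independent X"
      using insert.prems insert.hyps by (auto simp: vec.independent_insert)
    let ?f = "\<lambda>(k, x). k *s a + x"
    have "inj_on ?f (UNIV \<times> vec.span X)"
    proof (rule inj_onI, clarify)
      fix k l x y assume xy: "x \<in> vec.span X" "y \<in> vec.span X" "k *s a + x = l *s a + y"
      then have e: "(k - l) *s a = y - x" by (simp add: vec.scale_left_diff_distrib algebra_simps)
      have "k = l"
      proof (rule ccontr)
        assume "k \<noteq> l"
        then have "(1 / (k - l)) * (k - l) = 1" by simp
        then have "a = (1 / (k - l)) *s ((k - l) *s a)"
          by (simp only: vector_smult_assoc vector_smult_lid)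
        also have "\<dots> \<in> vec.span X"
          unfolding e using xy by (intro vec.span_scale vec.span_diff)
        finally show False using a by simp
      qed
      then show "k = l \<and> x = y" using xy(3) by simp
    qed
    moreover have "?f ` (UNIV \<times> vec.span X) = vec.span (insert a X)"
    proof -
      have "v \<in> vec.span (insert a X) \<longleftrightarrow> (\<exists>k. \<exists>x\<in>vec.span X. v = k *s a + x)" for v
        unfolding vec.span_breakdown_eq
        by (metis add.commute add_diff_cancel_left' diff_add_cancel)
      then show ?thesis by (auto simp: image_iff)
    qed
    ultimately have "card (vec.span (insert a X)) = card (UNIV \<times> vec.span X :: ('a \<times> ('a^'m)) set)"
      by (metis card_image)
    also have "\<dots> = CARD('a) * CARD('a) ^ card X"
      using insert.IH[OF X] by (simp add: card_cartesian_product)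
    finally show ?case using insert.hyps by simp
  qed
qed

text \<open>There are more vectors \<open>v\<close> than families of values of the pairings with the elements of \<open>X\<close>, so two
vectors have the same pairings, and their difference annihilates \<open>X\<close>.\<close>

lemma common_annihilator:
  fixes X :: "('b::{field,finite}^'m::finite) set"
  assumes "card X < CARD('m)"
  obtains v where "v \<noteq> 0" "\<And>x. x \<in> X \<Longrightarrow> (\<Sum>i\<in>UNIV. x $ i * v $ i) = 0"
proof -
  let ?r = "\<lambda>v :: 'b^'m. restrict (\<lambda>x. \<Sum>i\<in>UNIV. x $ i * v $ i) X"
  have "\<not> inj ?r"
  proof
    assume "inj ?r"
    moreover have "range ?r \<subseteq> X \<rightarrow>\<^sub>E UNIV" by (intro image_subsetI restrict_PiE_iff[THEN iffD2]) simp
    ultimately have "CARD('b^'m) \<le> card (X \<rightarrow>\<^sub>E (UNIV :: 'b set))"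
      by (intro card_inj_on_le) (auto intro: finite_PiE)
    then have "CARD('b) ^ CARD('m) \<le> CARD('b) ^ card X" by (simp add: card_PiE)
    moreover have "card {0, 1 :: 'b} \<le> CARD('b)" by (rule card_mono) auto
    ultimately show False using assms by (simp add: power_le_imp_le_exp leD)
  qed
  then obtain v w where vw: "v \<noteq> w" "?r v = ?r w" by (auto simp: inj_def)
  have "(\<Sum>i\<in>UNIV. x $ i * (v - w) $ i) = 0" if "x \<in> X" for x
    using fun_cong[OF vw(2), of x] that by (simp add: right_diff_distrib sum_subtractf)
  then show thesis using that[of "v - w"] vw(1) by simp
qed

section \<open>Operators triangular for a filtration\<close>

text \<open>If \<open>r = (T - lam k) w\<close> lies in \<open>W (l + 1)\<close> with \<open>l < k\<close>, then \<open>T\<close> acts on \<open>r\<close> modulo \<open>W l\<close> as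
\<open>lam l \<noteq> lam k\<close>. Subtracting \<open>r / (lam l - lam k)\<close> from \<open>w\<close> thus moves the error down to \<open>W l\<close>.
Repeating this turns \<open>f\<close> into an eigenvector without changing its class modulo \<open>W k\<close>.\<close>

lemma eigenvector_refinement:
  fixes W :: "nat \<Rightarrow> ('x \<Rightarrow> complex) set"
  assumes add: "\<And>f h. T (f + h) = T f + T h" and scale: "\<And>c f. T (cscale c f) = cscale c (T f)"
    and sub: "\<And>k. cfun.subspace (W k)" and mono: "\<And>k. W k \<subseteq> W (Suc k)" and zero: "W 0 = {0}"
    and step: "\<And>k f. k < N \<Longrightarrow> f \<in> W (Suc k) \<Longrightarrow> T f - cscale (lam k) f \<in> W k"
    and inj: "inj_on lam {..<N}"
    and k: "k < N" and f: "f \<in> W (Suc k)"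
  obtains w where "w - f \<in> W k" "T w = cscale (lam k) w"
proof -
  have diff: "T (f - h) = T f - T h" for f h
    using add[of "f - h" h] by simp
  have "\<exists>w. w - f \<in> W k \<and> T w - cscale (lam k) w \<in> W (k - m)" if "m \<le> k" for m
    using that
  proof (induction m)
    case 0
    have "f - f \<in> W k" using sub[of k] by (simp add: cfun.subspace_0)
    moreover have "T f - cscale (lam k) f \<in> W k" by (rule step[OF k f])
    ultimately show ?case by (intro exI[of _ f] conjI) (simp_all only: minus_nat.diff_0)
  next
    case (Suc m)
    from Suc.IH Suc_leD[OF Suc.prems]
    obtain w where w: "w - f \<in> W k" "T w - cscale (lam k) w \<in> W (k - m)" by blast
    define l where "l = k - Suc m"
    have l: "k - m = Suc l" "l < k" using Suc.prems by (auto simp: l_def)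
    define r where "r = T w - cscale (lam k) w"
    define d where "d = lam l - lam k"
    have "d \<noteq> 0" using inj l(2) k by (auto simp: d_def inj_on_def)
    have r: "r \<in> W (Suc l)" using w(2) l(1) by (simp add: r_def)
    let ?w = "w - cscale (1 / d) r"
    have "W (Suc l) \<subseteq> W k"
      using lift_Suc_mono_le[of W, OF mono] l(2) by (metis Suc_leI)
    then have "cscale (1 / d) r \<in> W k"
      using r sub cfun.subspace_scale by blast
    then have "(w - f) - cscale (1 / d) r \<in> W k" using w(1) sub cfun.subspace_diff by blast
    then have 1: "?w - f \<in> W k" by (simp add: algebra_simps)
    have "T ?w - cscale (lam k) ?w = r - cscale (1 / d) (T r - cscale (lam k) r)"
      unfolding diff scale r_def by (simp add: cscale_def fun_eq_iff algebra_simps)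
    also have "\<dots> = cscale (- 1 / d) (T r - cscale (lam l) r)"
      using \<open>d \<noteq> 0\<close> by (simp add: cscale_def fun_eq_iff d_def field_simps)
    finally have "T ?w - cscale (lam k) ?w \<in> W l"
      using cfun.subspace_scale[OF sub step[OF less_trans[OF l(2) k] r]] by (simp only:)
    with 1 show ?case unfolding l_def by blast
  qed
  from this[of k] obtain w where "w - f \<in> W k" "T w - cscale (lam k) w = 0"
    using zero by auto
  then show thesis using that by simp
qed

text \<open>By \<open>eigenvector_refinement\<close> each element of \<open>W (k + 1)\<close> is an eigenvector up to an element of
\<open>W k\<close>, so eigenvectors span by induction; strictness makes the eigenvector for \<open>lam k\<close> nonzero.
Conversely, an eigenvector has a first step of the filtration that contains it, and there its
eigenvalue can be read off.\<close>

lemma triangular_filtration_spectrum: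
  fixes W :: "nat \<Rightarrow> ('x \<Rightarrow> complex) set"
  assumes add: "\<And>f h. T (f + h) = T f + T h" and scale: "\<And>c f. T (cscale c f) = cscale c (T f)"
    and sub: "\<And>k. cfun.subspace (W k)" and mono: "\<And>k. W k \<subseteq> W (Suc k)" and zero: "W 0 = {0}"
    and step: "\<And>k f. k < N \<Longrightarrow> f \<in> W (Suc k) \<Longrightarrow> T f - cscale (lam k) f \<in> W k"
    and inj: "inj_on lam {..<N}"
    and strict: "\<And>k. k < N \<Longrightarrow> W k \<noteq> W (Suc k)"
  shows "diagonalizable_on (W N) T" and "eigenvalues_on (W N) T = lam ` {..<N}"
proof -
  note refine = eigenvector_refinement[of T W N lam, OF add scale sub mono zero step inj]
  have up: "W i \<subseteq> W j" if "i \<le> j" for i j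
    using lift_Suc_mono_le[of W, OF mono that] .
  have invariant: "T f \<in> W k" if "f \<in> W k" "k \<le> N" for k f
  proof (cases k)
    case 0
    have "T 0 = 0" using scale[of 0 0] by (simp add: cscale_def fun_eq_iff zero_fun_def)
    then show ?thesis using that 0 zero by simp
  next
    case (Suc j)
    then have "T f - cscale (lam j) f \<in> W k"
      using step[of j f] that mono by auto
    then have "(T f - cscale (lam j) f) + cscale (lam j) f \<in> W k"
      using that sub cfun.subspace_add cfun.subspace_scale by blast
    then show ?thesis by simp
  qed
  let ?E = "{f. \<exists>c. eigenvector_on (W N) T c f}"
  have spans: "W k \<subseteq> cfun.span ?E" if "k \<le> N" for k
    using that
  proof (induction k)
    case 0
    then show ?case using zero cfun.span_zero by auto
  next
    case (Suc k)
    show ?case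
    proof
      fix f assume f: "f \<in> W (Suc k)"
      have "k < N" using Suc by simp
      obtain w where w: "w - f \<in> W k" "T w = cscale (lam k) w"
        using refine[OF _ _ \<open>k < N\<close> f] by blast
      have "(w - f) + f \<in> W (Suc k)" using w(1) f sub mono cfun.subspace_add by blast
      then have "w \<in> W N" using up[of "Suc k" N] Suc.prems by auto
      then have "w \<in> cfun.span ?E"
        using w(2) by (cases "w = 0") (auto simp: eigenvector_on_def cfun.span_zero intro!: cfun.span_base)
      moreover have "w - f \<in> cfun.span ?E" using Suc w(1) by auto
      ultimately have "w - (w - f) \<in> cfun.span ?E" using cfun.span_diff by blast
      then show "f \<in> cfun.span ?E" by simp
    qed
  qed
  obtain E where E: "E \<subseteq> ?E" "cfun.independent E" "?E \<subseteq> cfun.span E"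
    using cfun.maximal_independent_subset[of ?E] by blast
  have "cfun.span E = W N"
  proof
    show "cfun.span E \<subseteq> W N"
      using E(1) sub by (intro cfun.span_minimal) (auto simp: eigenvector_on_def)
    show "W N \<subseteq> cfun.span E"
      using spans[of N] E(3) cfun.span_minimal[OF E(3)] by auto
  qed
  moreover have "linear_operator_on (W N) T"
    using sub invariant add scale by (auto simp: linear_operator_on_def)
  ultimately show "diagonalizable_on (W N) T"
    using E by (auto simp: diagonalizable_on_def)
  show "eigenvalues_on (W N) T = lam ` {..<N}"
  proof
    show "eigenvalues_on (W N) T \<subseteq> lam ` {..<N}"
    proof
      fix c assume "c \<in> eigenvalues_on (W N) T"
      then obtain f where f: "f \<in> W N" "f \<noteq> 0" "T f = cscale c f"
        by (auto simp: eigenvalues_on_def eigenvector_on_def)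
      define m where "m = (LEAST m. f \<in> W m)"
      have m: "f \<in> W m" "m \<le> N" using f(1) unfolding m_def by (auto intro: LeastI Least_le)
      have "m \<noteq> 0"
      proof
        assume "m = 0"
        then have "f \<in> W 0" using m(1) by simp
        then show False using zero f(2) by simp
      qed
      then obtain k where k: "m = Suc k" by (cases m) auto
      have notin: "f \<notin> W k" using not_less_Least[of k "\<lambda>m. f \<in> W m"] k unfolding m_def by simp
      have "cscale (c - lam k) f \<in> W k"
        using step[of k f] m k f(3) by (auto simp: cscale_def fun_diff_def algebra_simps)
      then have "cscale (1 / (c - lam k)) (cscale (c - lam k) f) \<in> W k"
        using sub cfun.subspace_scale by blast
      then have "c = lam k"
        using notin by (cases "c = lam k") (simp_all add: cscale_def)
      then show "c \<in> lam ` {..<N}" using k m by auto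
    qed
    show "lam ` {..<N} \<subseteq> eigenvalues_on (W N) T"
    proof clarify
      fix k assume k: "k < N"
      then obtain f where f: "f \<in> W (Suc k)" "f \<notin> W k" using strict[OF k] mono by blast
      obtain w where w: "w - f \<in> W k" "T w = cscale (lam k) w"
        using refine[OF _ _ k f(1)] by blast
      have "(w - f) + f \<in> W (Suc k)" using w(1) f(1) sub mono cfun.subspace_add by blast
      then have "w \<in> W N" using up[of "Suc k" N] k by auto
      moreover have "w \<noteq> 0"
      proof
        assume "w = 0"
        then have "- (w - f) \<in> W k" using w(1) sub cfun.subspace_neg by blast
        then show False using f(2) \<open>w = 0\<close> by simp
      qed
      ultimately show "lam k \<in> eigenvalues_on (W N) T"
        using w(2) by (auto simp: eigenvalues_on_def eigenvector_on_def)
    qed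
  qed
qed

section \<open>The filtration of the induced representation\<close>

lemma sum_fun_apply: "(\<Sum>a\<in>A. F a) x = (\<Sum>a\<in>A. F a x)"
  for F :: "'b \<Rightarrow> 'x \<Rightarrow> 'c::comm_monoid_add"
  by (induction A rule: infinite_finite_induct) auto

lemma intertwiner_eq_sum_opposite:
  fixes G :: "('a::{finite,field}^('n::finite + 'n)^('n + 'n)) set"
  shows "intertwiner G f g = (if g \<in> G then \<Sum>B\<in>UNIV. f (opposite B ** g) else 0)"
proof -
  have inj: "inj (\<lambda>B :: 'a^'n^'n. block_mat (mat 1) B 0 (mat 1))"
  proof (rule injI)
    fix B C :: "'a^'n^'n"
    assume "block_mat (mat 1) B 0 (mat 1) = block_mat (mat 1) C 0 (mat 1)"
    then have "block_mat (mat 1) B 0 (mat 1) $ Inl i $ Inr j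
      = block_mat (mat 1) C 0 (mat 1) $ Inl i $ Inr j" for i j by simp
    then show "B = C" by (simp add: vec_eq_iff)
  qed
  show ?thesis
    unfolding intertwiner_def unip_def by (simp add: sum.reindex[OF inj] opposite_def)
qed

lemma intertwiner_add: "intertwiner G (f + h) = intertwiner G f + intertwiner G h"
  by (simp add: fun_eq_iff intertwiner_def sum.distrib)

lemma intertwiner_cscale: "intertwiner G (cscale c f) = cscale c (intertwiner G f)"
  by (simp add: fun_eq_iff intertwiner_def cscale_def sum_distrib_left)

text \<open>The Moebius function of the lattice of subspaces, on an interval of rank \<open>j\<close>.\<close>

definition avoiding_coeff :: "nat \<Rightarrow> nat \<Rightarrow> complex" where
  "avoiding_coeff q j = (- 1) ^ j * of_nat q ^ (j choose 2)"

lemma avoiding_coeff_Suc: "avoiding_coeff q (Suc j) = - of_nat (q ^ j) * avoiding_coeff q j"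
  by (simp add: avoiding_coeff_def numeral_2_eq_2 power_add)

definition eigval :: "nat \<Rightarrow> nat \<Rightarrow> nat \<Rightarrow> complex" where
  "eigval q n j = of_nat (q ^ (n * (n - j))) * avoiding_coeff q j"

locale siegel_series =
  fixes G :: "('a::{finite,field}^('n::finite + 'n)^('n + 'n)) set" and \<alpha> :: "'a \<Rightarrow> complex"
  assumes G: "G \<in> {GL, SL}" and character: "is_character (UNIV - {0}) (*) \<alpha>"
begin

lemma alpha_nonzero: "x \<noteq> 0 \<Longrightarrow> \<alpha> x \<noteq> 0"
  and alpha_mult: "x \<noteq> 0 \<Longrightarrow> y \<noteq> 0 \<Longrightarrow> \<alpha> (x * y) = \<alpha> x * \<alpha> y"
  using character by (auto simp: is_character_def)

lemma alpha_1: "\<alpha> 1 = 1"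
  using alpha_mult[of 1 1] alpha_nonzero[of 1] by simp

lemma G_invertible: "g \<in> G \<Longrightarrow> invertible g"
  using G by (auto simp: GL_def SL_def invertible_det_nz)

lemma G_det: "g \<in> G \<Longrightarrow> det g \<noteq> 0"
  using G_invertible invertible_det_nz by blast

lemma det_1_in_G: "det g = 1 \<Longrightarrow> g \<in> G"
  using G by (auto simp: GL_def SL_def invertible_det_nz)

lemma G_mult: "g \<in> G \<Longrightarrow> h \<in> G \<Longrightarrow> g ** h \<in> G"
  using G by (auto simp: GL_def SL_def invertible_mult det_mul)

lemma G_divide: "g \<in> G \<Longrightarrow> h \<in> G \<Longrightarrow> g ** matrix_inv h \<in> G"
proof -
  assume g: "g \<in> G" and h: "h \<in> G"
  have "det (h ** matrix_inv h) = 1" by (simp add: matrix_inv_mult(1)[OF G_invertible[OF h]])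
  then have "det h * det (matrix_inv h) = 1" by (simp add: det_mul)
  then show ?thesis
    using g h G by (auto simp: GL_def SL_def invertible_det_nz det_mul)
qed

definition weight :: "'a^('n + 'n)^('n + 'n) \<Rightarrow> complex" where
  "weight g = (if g \<in> G then \<alpha> (det g) else 0)"

text \<open>The functions \<open>e\<^sub>X\<close>. They are indexed by arbitrary sets of vectors instead of subspaces, so that the
filtration can be stated with cardinalities and products of indicators are unions of sets.\<close>

definition containing :: "('a^('n + 'n)) set \<Rightarrow> 'a^('n + 'n)^('n + 'n) \<Rightarrow> complex" where
  "containing X g = weight g * of_bool (X \<subseteq> lower_row_space g)"

definition avoiding :: "('a^('n + 'n)) set \<Rightarrow> 'a^('n + 'n)^('n + 'n) \<Rightarrow> complex" where
  "avoiding X g = weight g * of_bool (vec.span X \<inter> lower_row_space g \<subseteq> {0})"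

definition filtration :: "nat \<Rightarrow> ('a^('n + 'n)^('n + 'n) \<Rightarrow> complex) set" where
  "filtration k = cfun.span (containing ` {X. card X < k})"

definition restrict_containing ::
  "'a^('n + 'n) \<Rightarrow> ('a^('n + 'n)^('n + 'n) \<Rightarrow> complex) \<Rightarrow> 'a^('n + 'n)^('n + 'n) \<Rightarrow> complex" where
  "restrict_containing t f g = of_bool (t \<in> lower_row_space g) * f g"

lemma subspace_filtration: "cfun.subspace (filtration k)"
  by (simp add: filtration_def)

lemma filtration_mono: "j \<le> k \<Longrightarrow> filtration j \<subseteq> filtration k"
  unfolding filtration_def by (intro cfun.span_mono image_mono) auto

lemma filtration_0: "filtration 0 = {0}"
  by (simp add: filtration_def)

lemma containing_in_filtration: "card X < k \<Longrightarrow> containing X \<in> filtration k"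
  unfolding filtration_def by (intro cfun.span_base) auto

lemma span_subset_lower_row_space_iff: "vec.span X \<subseteq> lower_row_space g \<longleftrightarrow> X \<subseteq> lower_row_space g"
  using vec.span_minimal[OF _ subspace_lower_row_space] vec.span_superset by blast

text \<open>A dependent set can be replaced by a smaller one with the same span.\<close>

lemma containing_dependent_in_filtration:
  assumes "vec.dependent X" "card X \<le> k"
  shows "containing X \<in> filtration k"
proof -
  obtain Y where Y: "Y \<subseteq> X" "vec.independent Y" "X \<subseteq> vec.span Y"
    by (rule vec.maximal_independent_subset)
  have "Y \<subset> X" using assms(1) Y by auto
  then have "card Y < card X" by (simp add: psubset_card_mono)
  moreover have "X \<subseteq> lower_row_space g \<longleftrightarrow> Y \<subseteq> lower_row_space g" for g
    using Y(1,3) span_subset_lower_row_space_iff[of Y g] by blast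
  then have "containing X = containing Y" by (simp add: containing_def fun_eq_iff)
  ultimately show ?thesis using assms(2) containing_in_filtration[of Y k] by simp
qed

lemma restrict_containing_in_filtration:
  assumes "f \<in> filtration k"
  shows "restrict_containing t f \<in> filtration (Suc k)"
  using assms unfolding filtration_def[of k]
proof (induction rule: cfun.span_induct)
  case base
  have eq: "restrict_containing t (f + h) = restrict_containing t f + restrict_containing t h"
    "restrict_containing t (cscale c f) = cscale c (restrict_containing t f)"
    "restrict_containing t 0 = 0" for f h c
    by (simp_all add: restrict_containing_def cscale_def fun_eq_iff algebra_simps)
  note F = subspace_filtration[of "Suc k"]
  show ?case
    unfolding cfun.subspace_def mem_Collect_eq eq
    using cfun.subspace_0[OF F] cfun.subspace_add[OF F] cfun.subspace_scale[OF F] by blast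
next
  case (step f)
  then obtain X where X: "card X < k" "f = containing X" by auto
  have "card (insert t X) < Suc k" using X(1) card_insert_le_m1 by (simp add: card_insert_if)
  moreover have "restrict_containing t f = containing (insert t X)"
    by (auto simp: X(2) restrict_containing_def containing_def fun_eq_iff)
  ultimately show ?case by (simp only: containing_in_filtration)
qed

text \<open>The operator counts the complements of the row space of \<open>g\<close> that contain \<open>X\<close>.\<close>

lemma intertwiner_containing:
  assumes X: "vec.independent X"
  shows "intertwiner G (containing X)
    = cscale (of_nat (CARD('a) ^ (CARD('n) * (CARD('n) - card X)))) (avoiding X)"
proof
  fix g
  show "intertwiner G (containing X) g
    = cscale (of_nat (CARD('a) ^ (CARD('n) * (CARD('n) - card X)))) (avoiding X) g"
  proof (cases "g \<in> G")
    case True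
    have w: "weight (opposite B ** g) = weight g" for B
      using G_mult[OF det_1_in_G[OF det_opposite] True]
      by (simp add: weight_def True det_mul det_opposite)
    have "intertwiner G (containing X) g
      = (\<Sum>B\<in>UNIV. weight g * of_bool (X \<subseteq> lower_row_space (opposite B ** g)))"
      by (simp add: intertwiner_eq_sum_opposite True containing_def w)
    also have "\<dots> = weight g * (\<Sum>B\<in>UNIV. of_bool (X \<subseteq> lower_row_space (opposite B ** g)))"
      by (simp add: sum_distrib_left)
    also have "(\<Sum>B\<in>UNIV. of_bool (X \<subseteq> lower_row_space (opposite B ** g)))
      = (of_nat (card {B. X \<subseteq> lower_row_space (opposite B ** g)}) :: complex)"
      by (simp add: sum_of_bool_eq)
    also have "card {B. X \<subseteq> lower_row_space (opposite B ** g)}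
      = of_bool (vec.span X \<inter> lower_row_space g \<subseteq> {0}) * CARD('a) ^ (CARD('n) * (CARD('n) - card X))"
      using card_opposite_containing[OF X G_invertible[OF True]] by simp
    finally show ?thesis by (simp add: cscale_def avoiding_def)
  next
    case False
    then show ?thesis
      by (simp add: intertwiner_eq_sum_opposite cscale_def avoiding_def weight_def)
  qed
qed

text \<open>Suppose that the span of \<open>X\<close> meets \<open>S\<^sub>g\<close> trivially. Then a nonzero element of \<open>S\<^sub>g\<close> in the span of
\<open>insert t X\<close> has a nonzero coefficient at \<open>t\<close>, so it can be scaled to the form \<open>t + x\<close> with \<open>x\<close> in
the span of \<open>X\<close>; and at most one \<open>x\<close> occurs, since two of them differ by an element of \<open>S\<^sub>g\<close>.\<close>

lemma avoiding_insert:
  assumes "t \<notin> vec.span X"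
  shows "avoiding (insert t X)
    = avoiding X - (\<Sum>x\<in>vec.span X. restrict_containing (t + x) (avoiding X))"
proof
  fix g :: "'a^('n + 'n)^('n + 'n)"
  let ?S = "lower_row_space g"
  let ?A = "\<lambda>X :: ('a^('n + 'n)) set. vec.span X \<inter> ?S \<subseteq> {0}"
  note S = subspace_lower_row_space[of g]
  have "of_bool (?A (insert t X))
    = (of_bool (?A X) - (\<Sum>x\<in>vec.span X. of_bool (t + x \<in> ?S) * of_bool (?A X)) :: complex)"
  proof (cases "?A X")
    case False
    then have "\<not> ?A (insert t X)"
      using vec.span_mono[of X "insert t X"] by blast
    with False show ?thesis by simp
  next
    case True
    have unique: "x = y" if "x \<in> vec.span X" "y \<in> vec.span X" "t + x \<in> ?S" "t + y \<in> ?S" for x y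
    proof -
      have "(t + x) - (t + y) \<in> ?S" using that(3,4) by (rule vec.subspace_diff[OF S])
      then have "x - y \<in> vec.span X \<inter> ?S" using that(1,2) by (simp add: vec.span_diff)
      then show ?thesis using True by auto
    qed
    have ex: "(\<exists>x\<in>vec.span X. t + x \<in> ?S) \<longleftrightarrow> \<not> ?A (insert t X)"
    proof
      assume "\<exists>x\<in>vec.span X. t + x \<in> ?S"
      then obtain x where x: "x \<in> vec.span X" "t + x \<in> ?S" by blast
      have "t + x \<in> vec.span (insert t X)"
        using vec.span_add[OF vec.span_base[of t "insert t X"], of x]
          x(1) vec.span_mono[of X "insert t X"] by auto
      moreover have "t + x \<noteq> 0"
        using assms vec.span_neg[OF x(1)] by (metis add_eq_0_iff2)
      ultimately show "\<not> ?A (insert t X)" using x(2) by blast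
    next
      assume "\<not> ?A (insert t X)"
      then obtain s where s: "s \<in> vec.span (insert t X)" "s \<in> ?S" "s \<noteq> 0" by auto
      then obtain k where k: "s - k *s t \<in> vec.span X" using vec.span_breakdown_eq by blast
      have "k \<noteq> 0" using k s True by auto
      have "(1 / k) *s (s - k *s t) \<in> vec.span X" using k by (rule vec.span_scale)
      moreover have "t + (1 / k) *s (s - k *s t) = (1 / k) *s s"
        using \<open>k \<noteq> 0\<close> by (simp add: vec_eq_iff field_simps)
      then have "t + (1 / k) *s (s - k *s t) \<in> ?S" using s(2) vec.subspace_scale[OF S] by simp
      ultimately show "\<exists>x\<in>vec.span X. t + x \<in> ?S" by blast
    qed
    have "(\<Sum>x\<in>vec.span X. of_bool (t + x \<in> ?S)) = (of_bool (\<not> ?A (insert t X)) :: complex)"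
    proof (cases "\<exists>x\<in>vec.span X. t + x \<in> ?S")
      case True
      then obtain y where y: "y \<in> vec.span X" "t + y \<in> ?S" by blast
      then have "(\<Sum>x\<in>vec.span X. of_bool (t + x \<in> ?S)) = (\<Sum>x\<in>vec.span X. of_bool (x = y) :: complex)"
        using unique by (intro sum.cong) (auto simp: of_bool_def)
      also have "\<dots> = 1" using y(1) by (simp add: of_bool_def)
      finally show ?thesis using True ex by simp
    next
      case False
      then show ?thesis using ex by (simp add: of_bool_def)
    qed
    then show ?thesis using True by (simp add: of_bool_def)
  qed
  then have "avoiding (insert t X) g = weight g * (of_bool (?A X)
      - (\<Sum>x\<in>vec.span X. of_bool (t + x \<in> ?S) * of_bool (?A X)))"
    by (simp only: avoiding_def)
  also have "\<dots> = (avoiding X - (\<Sum>x\<in>vec.span X. restrict_containing (t + x) (avoiding X))) g"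
    by (simp add: avoiding_def restrict_containing_def sum_fun_apply right_diff_distrib
        sum_distrib_left mult.left_commute)
  finally show "avoiding (insert t X) g
    = (avoiding X - (\<Sum>x\<in>vec.span X. restrict_containing (t + x) (avoiding X))) g" .
qed

text \<open>In the recursion \<open>avoiding_insert\<close> the leading part of \<open>avoiding X\<close> is a multiple of
\<open>containing X\<close>. Under the condition \<open>X \<subseteq> S\<^sub>g\<close>, the statements \<open>t + x \<in> S\<^sub>g\<close> and \<open>t \<in> S\<^sub>g\<close> are
equivalent, so that all \<open>q\<^sup>j\<close> summands contribute the same multiple of \<open>containing (insert t X)\<close>
with sign \<open>-1\<close>. The recursion \<open>avoiding_coeff_Suc\<close> of the coefficients says exactly this.\<close>

lemma avoiding_leading_term:
  assumes "vec.independent X"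
  shows "avoiding X - cscale (avoiding_coeff CARD('a) (card X)) (containing X) \<in> filtration (card X)"
proof -
  have "finite X" by simp
  then show ?thesis using assms
  proof (induction X)
    case empty
    have "avoiding {} - cscale (avoiding_coeff CARD('a) 0) (containing {}) = 0"
      by (auto simp: fun_eq_iff avoiding_def containing_def cscale_def avoiding_coeff_def numeral_2_eq_2)
    then show ?case by (simp only: filtration_0 card.empty singleton_iff)
  next
    case (insert t X)
    have t: "t \<notin> vec.span X" and X: "vec.independent X"
      using insert.prems insert.hyps by (auto simp: vec.independent_insert)
    let ?k = "card X"
    let ?c = "avoiding_coeff CARD('a) ?k"
    note F = subspace_filtration[of "Suc ?k"]
    define r where "r = avoiding X - cscale ?c (containing X)"
    have r: "r \<in> filtration ?k" unfolding r_def using insert.IH[OF X] .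
    have rc: "restrict_containing (t + x) (avoiding X)
        = cscale ?c (containing (insert t X)) + restrict_containing (t + x) r"
      if x: "x \<in> vec.span X" for x
    proof
      fix g
      have "t + x \<in> lower_row_space g \<longleftrightarrow> t \<in> lower_row_space g" if "X \<subseteq> lower_row_space g"
      proof -
        have "x \<in> lower_row_space g" using that x span_subset_lower_row_space_iff by blast
        then show ?thesis
          using vec.span_add_eq2[of x "lower_row_space g" t] subspace_lower_row_space[of g]
          by (metis vec.span_eq_iff)
      qed
      then have "of_bool (t + x \<in> lower_row_space g) * containing X g = containing (insert t X) g"
        by (auto simp: containing_def)
      moreover have "avoiding X g = ?c * containing X g + r g"
        by (simp add: r_def cscale_def)
      ultimately show "restrict_containing (t + x) (avoiding X) g
        = (cscale ?c (containing (insert t X)) + restrict_containing (t + x) r) g"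
        by (simp add: restrict_containing_def cscale_def algebra_simps)
    qed
    have "(\<Sum>x\<in>vec.span X. restrict_containing (t + x) (avoiding X))
      = (\<Sum>x\<in>vec.span X. cscale ?c (containing (insert t X)) + restrict_containing (t + x) r)"
      by (rule sum.cong[OF refl rc])
    also have "\<dots> = cscale (of_nat (CARD('a) ^ ?k) * ?c) (containing (insert t X))
      + (\<Sum>x\<in>vec.span X. restrict_containing (t + x) r)"
      by (simp add: sum.distrib cfun.sum_constant_scale card_span_independent[OF X] del: sum_constant)
    finally have sum: "(\<Sum>x\<in>vec.span X. restrict_containing (t + x) (avoiding X))
      = cscale (of_nat (CARD('a) ^ ?k) * ?c) (containing (insert t X))
      + (\<Sum>x\<in>vec.span X. restrict_containing (t + x) r)" .
    have card: "card (insert t X) = Suc ?k" using insert.hyps by simp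
    have "avoiding (insert t X) - cscale (avoiding_coeff CARD('a) (Suc ?k)) (containing (insert t X))
      = cscale ?c (containing X) + r - (\<Sum>x\<in>vec.span X. restrict_containing (t + x) r)"
      unfolding avoiding_insert[OF t] sum avoiding_coeff_Suc
      by (simp add: r_def fun_eq_iff cscale_def)
    also have "\<dots> \<in> filtration (Suc ?k)"
    proof (intro cfun.subspace_diff[OF F] cfun.subspace_add[OF F] cfun.subspace_scale[OF F]
        cfun.subspace_sum[OF F] restrict_containing_in_filtration containing_in_filtration)
      show "r \<in> filtration (Suc ?k)" using r filtration_mono[of ?k "Suc ?k"] by auto
    qed (use r in auto)
    finally show ?case by (simp only: card)
  qed
qed

lemma intertwiner_containing_independent:
  assumes "vec.independent X"
  shows "intertwiner G (containing X)
    - cscale (eigval CARD('a) CARD('n) (card X)) (containing X) \<in> filtration (card X)"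
proof -
  have "intertwiner G (containing X) - cscale (eigval CARD('a) CARD('n) (card X)) (containing X)
    = cscale (of_nat (CARD('a) ^ (CARD('n) * (CARD('n) - card X))))
        (avoiding X - cscale (avoiding_coeff CARD('a) (card X)) (containing X))"
    by (simp add: intertwiner_containing[OF assms] eigval_def cscale_def fun_eq_iff algebra_simps)
  then show ?thesis
    using cfun.subspace_scale[OF subspace_filtration avoiding_leading_term[OF assms]] by (simp only:)
qed

text \<open>On the generators with exactly \<open>k\<close> independent vectors this is
\<open>intertwiner_containing_independent\<close>. All other generators of \<open>filtration (k + 1)\<close> lie in
\<open>filtration k\<close>, which is invariant by induction.\<close>

lemma intertwiner_triangular:
  assumes "f \<in> filtration (Suc k)"
  shows "intertwiner G f - cscale (eigval CARD('a) CARD('n) k) f \<in> filtration k"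
  using assms
proof (induction k arbitrary: f rule: less_induct)
  case (less k)
  let ?D = "\<lambda>f. intertwiner G f - cscale (eigval CARD('a) CARD('n) k) f"
  have lin: "?D 0 = 0" "?D (f + h) = ?D f + ?D h" "?D (cscale c f) = cscale c (?D f)" for f h c
    unfolding intertwiner_add intertwiner_cscale
    by (simp_all add: fun_eq_iff cscale_def intertwiner_def algebra_simps)
  note F = subspace_filtration[of k]
  show ?case
    using less.prems unfolding filtration_def[of "Suc k"]
  proof (induction rule: cfun.span_induct)
    case base
    show ?case
      unfolding cfun.subspace_def mem_Collect_eq lin
      using cfun.subspace_0[OF F] cfun.subspace_add[OF F] cfun.subspace_scale[OF F] by blast
  next
    case (step f)
    then obtain X where "card X < Suc k" "f = containing X" by blast
    then have X: "card X \<le> k" "f = containing X" by simp_all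
    show ?case
    proof (cases "vec.independent X \<and> card X = k")
      case True
      then show ?thesis using intertwiner_containing_independent[of X] unfolding X(2) by blast
    next
      case False
      have fk: "f \<in> filtration k"
        using False X containing_dependent_in_filtration[of X k] containing_in_filtration[of X k]
        by (cases "vec.independent X") auto
      have "k \<noteq> 0"
      proof
        assume "k = 0"
        then have "X = {}" using X(1) by simp
        then show False using False \<open>k = 0\<close> by (simp add: vec.independent_empty)
      qed
      then obtain j where j: "k = Suc j" by (cases k) auto
      then have jk: "j < k" "j \<le> k" by simp_all
      have "intertwiner G f - cscale (eigval CARD('a) CARD('n) j) f \<in> filtration k"
        using less.IH[OF jk(1) fk[unfolded j]] filtration_mono[OF jk(2)] by blast
      then have "(intertwiner G f - cscale (eigval CARD('a) CARD('n) j) f)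
          + cscale (eigval CARD('a) CARD('n) j) f \<in> filtration k"
        using cfun.subspace_add[OF F] cfun.subspace_scale[OF F fk] by blast
      then have "intertwiner G f \<in> filtration k" by simp
      then show ?thesis
        using cfun.subspace_diff[OF F] cfun.subspace_scale[OF F fk] by blast
    qed
  qed
qed

lemma subspace_Ind: "cfun.subspace (Ind G chi)"
  by (auto simp: cfun.subspace_def Ind_def cscale_def algebra_simps)

text \<open>A function in the induced representation is determined by one value for each subspace \<open>S\<close> of the form
\<open>S\<^sub>h\<close>, and the indicator of \<open>S\<^sub>g = S\<^sub>h\<close> is that of the \<open>n\<close> lower rows of \<open>h\<close> lying in \<open>S\<^sub>g\<close>.\<close>

lemma filtration_top:
  assumes chi: "\<And>p. p \<in> parabolic G \<Longrightarrow> chi p = \<alpha> (det p)"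
  shows "filtration (Suc CARD('n)) = Ind G chi"
proof
  have "containing X \<in> Ind G chi" for X
  proof -
    have "containing X (p ** g) = chi p * containing X g" if p: "p \<in> parabolic G" and g: "g \<in> G" for p g
    proof -
      obtain A B D where pG: "p \<in> G" and "p = block_mat A B 0 D"
        using p by (auto simp: parabolic_def)
      then have "lower_row_space (p ** g) = lower_row_space g"
        using lower_row_space_block_triangular_mult G_invertible by blast
      moreover have "weight (p ** g) = chi p * weight g"
        using pG g by (simp add: weight_def G_mult det_mul alpha_mult G_det chi[OF p])
      ultimately show ?thesis by (simp add: containing_def)
    qed
    then show ?thesis by (auto simp: Ind_def containing_def weight_def)
  qed
  then show "filtration (Suc CARD('n)) \<subseteq> Ind G chi"
    unfolding filtration_def by (intro cfun.span_minimal subspace_Ind) auto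
  show "Ind G chi \<subseteq> filtration (Suc CARD('n))"
  proof
    fix f assume f: "f \<in> Ind G chi"
    define r where "r = inv_into G lower_row_space"
    have r: "r S \<in> G \<and> lower_row_space (r S) = S" if "S \<in> lower_row_space ` G" for S
      unfolding r_def using that by (intro conjI inv_into_into f_inv_into_f)
    let ?rows = "\<lambda>g :: 'a^('n + 'n)^('n + 'n). range (\<lambda>i. g $ Inr i)"
    \<comment> \<open>an interpolation formula: the term of \<open>S\<close> is supported on the \<open>g\<close> with \<open>S\<^sub>g = S\<close>\<close>
    have "f = (\<Sum>S\<in>lower_row_space ` G. cscale (f (r S) / \<alpha> (det (r S))) (containing (?rows (r S))))"
    proof
      fix g
      show "f g = (\<Sum>S\<in>lower_row_space ` G.
          cscale (f (r S) / \<alpha> (det (r S))) (containing (?rows (r S)))) g"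
      proof (cases "g \<in> G")
        case True
        define h where "h = r (lower_row_space g)"
        have h: "h \<in> G" "lower_row_space h = lower_row_space g" using r[of "lower_row_space g"] True by (auto simp: h_def)
        define p where "p = g ** matrix_inv h"
        obtain A B D where p: "p = block_mat A B 0 D"
          unfolding p_def by (rule lower_row_space_eqD[OF G_invertible[OF h(1)] h(2)[symmetric]])
        have "p \<in> parabolic G"
          using G_divide[OF True h(1)] p by (auto simp: parabolic_def p_def[symmetric])
        moreover have ph: "p ** h = g"
          by (simp add: p_def matrix_mul_assoc[symmetric] matrix_inv_mult(2)[OF G_invertible[OF h(1)]])
        ultimately have "f g = \<alpha> (det p) * f h"
          using f h(1) chi[of p] by (auto simp: Ind_def)
        moreover have "\<alpha> (det g) = \<alpha> (det p) * \<alpha> (det h)"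
          using G_det[OF True] unfolding ph[symmetric] det_mul by (simp add: alpha_mult)
        ultimately have fg: "f g = f h / \<alpha> (det h) * \<alpha> (det g)"
          using alpha_nonzero[OF G_det[OF h(1)]] by simp
        have "(\<Sum>S\<in>lower_row_space ` G. f (r S) / \<alpha> (det (r S)) * containing (?rows (r S)) g)
          = (\<Sum>S\<in>lower_row_space ` G. if S = lower_row_space g then f h / \<alpha> (det h) * \<alpha> (det g) else 0)"
        proof (rule sum.cong[OF refl])
          fix S assume S: "S \<in> lower_row_space ` G"
          have "?rows (r S) \<subseteq> lower_row_space g \<longleftrightarrow> S = lower_row_space g"
            using lower_rows_subset_lower_row_space_iff[of "r S" g] r[OF S] G_invertible True by auto
          then show "f (r S) / \<alpha> (det (r S)) * containing (?rows (r S)) g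
            = (if S = lower_row_space g then f h / \<alpha> (det h) * \<alpha> (det g) else 0)"
            by (simp add: containing_def weight_def True h_def)
        qed
        also have "\<dots> = f g" using True fg by simp
        finally show ?thesis by (simp add: sum_fun_apply cscale_def)
      next
        case False
        then show ?thesis
          using f by (simp add: sum_fun_apply cscale_def containing_def weight_def Ind_def)
      qed
    qed
    also have "\<dots> \<in> filtration (Suc CARD('n))"
    proof (intro cfun.subspace_sum[OF subspace_filtration] cfun.subspace_scale[OF subspace_filtration]
        containing_in_filtration)
      fix S
      show "card (?rows (r S)) < Suc CARD('n)"
        using card_image_le[of UNIV "\<lambda>i. r S $ Inr i"] by simp
    qed
    finally show "f \<in> filtration (Suc CARD('n))" .
  qed
qed

text \<open>Each generator of the larger space arises from a generator with one vector less by multiplication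
with an indicator, and this multiplication raises the level by at most one.\<close>

lemma filtration_stationary:
  assumes "filtration k = filtration (Suc k)"
  shows "filtration (Suc k) = filtration (Suc (Suc k))"
proof
  show "filtration (Suc k) \<subseteq> filtration (Suc (Suc k))" by (rule filtration_mono) simp
  have "containing X \<in> filtration (Suc k)" if "card X < Suc (Suc k)" for X
  proof (cases "X = {}")
    case True
    then show ?thesis by (simp add: containing_in_filtration)
  next
    case False
    then obtain t where t: "t \<in> X" by auto
    then have "card (X - {t}) < Suc k" using that by simp
    then have "restrict_containing t (containing (X - {t})) \<in> filtration (Suc k)"
      using assms containing_in_filtration restrict_containing_in_filtration by blast
    moreover have "restrict_containing t (containing (X - {t})) = containing X"
      using t by (auto simp: restrict_containing_def containing_def fun_eq_iff)
    ultimately show ?thesis by simp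
  qed
  then show "filtration (Suc (Suc k)) \<subseteq> filtration (Suc k)"
    unfolding filtration_def[of "Suc (Suc k)"]
    by (intro cfun.span_minimal subspace_filtration) auto
qed

lemma containing_opposite:
  "containing X (opposite B) = of_bool (\<forall>t\<in>X. second_half t = first_half t v* B)"
  by (simp add: containing_def weight_def det_1_in_G det_opposite alpha_1 subset_iff lower_row_space_opposite
      Ball_def)

text \<open>For fewer than \<open>n\<close> vectors there is a nonzero column \<open>v\<close> that is annihilated by all their first
halves. Adding a matrix \<open>E\<close> of trace \<open>1\<close> whose columns are multiples of \<open>v\<close> does not change whether
the graph of \<open>B\<close> contains \<open>X\<close>, and it carries trace \<open>0\<close> to trace \<open>1\<close>.\<close>

lemma trace_balanced_on_filtration:
  assumes "f \<in> filtration CARD('n)"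
  shows "(\<Sum>B | trace B = 0. f (opposite B)) = (\<Sum>B | trace B = 1. f (opposite B))"
  using assms unfolding filtration_def
proof (induction rule: cfun.span_induct)
  case base
  show ?case
    by (auto simp: cfun.subspace_def cscale_def sum.distrib sum_distrib_left[symmetric])
next
  case (step f)
  then obtain X where X: "card X < CARD('n)" "f = containing X" by auto
  have "card (first_half ` X) < CARD('n)" using X(1) card_image_le[of X first_half] by simp
  then obtain v where v: "v \<noteq> 0" "\<And>x. x \<in> first_half ` X \<Longrightarrow> (\<Sum>i\<in>UNIV. x $ i * v $ i) = 0"
    using common_annihilator[of "first_half ` X"] by auto
  then obtain m where m: "v $ m \<noteq> 0" by (auto simp: vec_eq_iff)
  define E :: "'a^'n^'n" where "E = (\<chi> i j. if j = m then v $ i / v $ m else 0)"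
  have tr: "trace E = 1"
    using m by (simp add: trace_def E_def if_distrib cong: if_cong)
  have E0: "first_half t v* E = 0" if "t \<in> X" for t
  proof -
    have "(first_half t v* E) $ j = 0" for j
    proof (cases "j = m")
      case True
      then have "(first_half t v* E) $ j = (\<Sum>i\<in>UNIV. first_half t $ i * v $ i) / v $ m"
        by (simp add: vector_matrix_mult_def E_def sum_divide_distrib)
      then show ?thesis using v(2)[of "first_half t"] that by simp
    qed (simp add: vector_matrix_mult_def E_def)
    then show ?thesis by (simp add: vec_eq_iff)
  qed
  have shift: "f (opposite (B + E)) = f (opposite B)" for B
    by (simp add: X(2) containing_opposite vector_matrix_mult_add_rdistrib E0)
  show ?case
  proof (rule sum.reindex_bij_witness[where i = "\<lambda>B. B - E" and j = "\<lambda>B. B + E"])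
    fix B
    show "f (opposite (B + E)) = f (opposite B)" by (rule shift)
  qed (auto simp: trace_add trace_sub tr)
qed

lemma filtration_strict:
  assumes "k \<le> CARD('n)"
  shows "filtration k \<noteq> filtration (Suc k)"
proof
  assume eq: "filtration k = filtration (Suc k)"
  have "filtration m = filtration (Suc m)" if "k \<le> m" for m
    using that by (induction m rule: dec_induct) (use eq filtration_stationary in blast)+
  then have top: "filtration CARD('n) = filtration (Suc CARD('n))" using assms by blast
  \<comment> \<open>The graph of \<open>B\<close> contains all \<open>(e\<^sub>i, 0)\<close> only for \<open>B = 0\<close>, which has trace \<open>0\<close>.\<close>
  define e :: "'n \<Rightarrow> 'a^('n + 'n)" where "e i = axis (Inl i) 1" for i
  have half: "first_half (e i) = axis i 1" "second_half (e i) = 0" for i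
    by (simp_all add: e_def first_half_def second_half_def axis_def vec_eq_iff)
  have row: "axis i 1 v* B = B $ i" for i and B :: "'a^'n^'n"
    by (simp add: vec_eq_iff vector_matrix_mult_def axis_def if_distrib[of "\<lambda>x. x * _"] cong: if_cong)
  have "card (range e) < Suc CARD('n)" using card_image_le[of UNIV e] by simp
  then have "containing (range e) \<in> filtration CARD('n)"
    unfolding top by (rule containing_in_filtration)
  from trace_balanced_on_filtration[OF this]
  have bal: "(\<Sum>B | trace B = 0. containing (range e) (opposite B))
    = (\<Sum>B | trace B = 1. containing (range e) (opposite B))" .
  have val: "containing (range e) (opposite B) = (if B = 0 then 1 else 0)" for B
    by (auto simp: containing_opposite half row vec_eq_iff)
  have "trace (0 :: 'a^'n^'n) = 0" by (simp add: trace_def)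
  then show False using bal unfolding val by (simp add: if_distrib)
qed

end

section \<open>The spectrum\<close>

lemma Suc_choose_2: "Suc m choose 2 = m + (m choose 2)"
  by (simp add: numeral_2_eq_2)

text \<open>With \<open>n = i + j\<close> this rewrites the exponent \<open>n(n - j) + j(j - 1)/2\<close> of the scalar on the step \<open>j\<close> in
terms of \<open>i\<close>.\<close>

lemma exponent_identity:
  "(i + j) * i + (j choose 2) = ((i + j) choose 2) + ((i + 1) choose 2)"
proof (induction j)
  case 0
  show ?case by (induction i) (simp_all add: Suc_choose_2 binomial_eq_0)
next
  case (Suc j)
  then show ?case by (simp add: Suc_choose_2)
qed

lemma eigval_eq:
  assumes "i \<le> n"
  shows "eigval q n (n - i) = (- 1) ^ (n - i) * of_nat q ^ ((n choose 2) + ((i + 1) choose 2))"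
proof -
  have "n * (n - (n - i)) + ((n - i) choose 2) = (n choose 2) + ((i + 1) choose 2)"
    using exponent_identity[of i "n - i"] assms by simp
  then have "of_nat q ^ ((n choose 2) + ((i + 1) choose 2))
    = (of_nat q ^ (n * (n - (n - i))) * of_nat q ^ ((n - i) choose 2) :: complex)"
    by (metis power_add)
  then show ?thesis by (simp add: eigval_def avoiding_coeff_def)
qed

text \<open>Already the absolute values differ, because the exponents of \<open>q\<close> are strictly increasing in
\<open>i\<close>.\<close>

lemma eigval_inj:
  assumes "q \<ge> 2"
  shows "inj_on (eigval q n) {..<Suc n}"
proof -
  let ?c = "\<lambda>i. Suc i choose 2"
  have "strict_mono ?c" by (rule strict_monoI_Suc) (simp add: Suc_choose_2)
  have "i = i'" if i: "i \<le> n" "i' \<le> n" and eq: "eigval q n (n - i) = eigval q n (n - i')" for i i'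
  proof -
    have "norm (eigval q n (n - i)) = norm (eigval q n (n - i'))" using eq by simp
    then have "real q ^ ((n choose 2) + ?c i) = real q ^ ((n choose 2) + ?c i')"
      unfolding eigval_eq[OF i(1)] eigval_eq[OF i(2)] by (simp add: norm_mult norm_power)
    then have "?c i = ?c i'" using assms by (simp add: power_inject_exp)
    then show ?thesis using strict_mono_eq[OF \<open>strict_mono ?c\<close>, of i i'] by blast
  qed
  note inj = this
  show ?thesis
  proof (rule inj_onI)
    fix j j' assume "j \<in> {..<Suc n}" "j' \<in> {..<Suc n}" "eigval q n j = eigval q n j'"
    then show "j = j'" using inj[of "n - j" "n - j'"] by auto
  qed
qed

lemma eigval_image:
  "eigval q n ` {..<Suc n}
    = {(- 1) ^ (n - i) * of_nat q ^ ((n choose 2) + ((i + 1) choose 2)) | i. 0 \<le> i \<and> i \<le> n}"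
    (is "?L = ?R")
proof
  show "?L \<subseteq> ?R"
  proof
    fix c assume "c \<in> ?L"
    then obtain j where "j < Suc n" "c = eigval q n j" by blast
    then have "j \<le> n" "c = eigval q n j" by simp_all
    then have "c = eigval q n (n - (n - j))" by simp
    then show "c \<in> ?R" using eigval_eq[of "n - j" n q] by auto
  qed
  show "?R \<subseteq> ?L"
  proof
    fix c assume "c \<in> ?R"
    then obtain i where "i \<le> n" "c = eigval q n (n - i)" using eigval_eq by auto
    then show "c \<in> ?L" by auto
  qed
qed

theorem (in siegel_series) intertwiner_spectrum:
  assumes chi: "\<And>p. p \<in> parabolic G \<Longrightarrow> chi p = \<alpha> (det p)"
  shows "diagonalizable_on (Ind G chi) (intertwiner G)"
    and "eigenvalues_on (Ind G chi) (intertwiner G)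
      = eigval CARD('a) CARD('n) ` {..<Suc CARD('n)}"
proof -
  have "card {0, 1 :: 'a} \<le> CARD('a)" by (rule card_mono) auto
  then have "2 \<le> CARD('a)" by simp
  note inj = eigval_inj[OF this, of "CARD('n)"]
  have mono: "filtration k \<subseteq> filtration (Suc k)" for k by (rule filtration_mono) simp
  have strict: "k < Suc CARD('n) \<Longrightarrow> filtration k \<noteq> filtration (Suc k)" for k
    by (rule filtration_strict) simp
  have top: "filtration (Suc CARD('n)) = Ind G chi" by (rule filtration_top) (rule chi)
  note spectrum = triangular_filtration_spectrum[where T = "intertwiner G" and W = filtration
      and lam = "eigval CARD('a) CARD('n)" and N = "Suc CARD('n)",
      OF intertwiner_add intertwiner_cscale subspace_filtration mono filtration_0
        intertwiner_triangular inj strict]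
  show "diagonalizable_on (Ind G chi) (intertwiner G)"
    unfolding top[symmetric] by (rule spectrum(1))
  show "eigenvalues_on (Ind G chi) (intertwiner G)
      = eigval CARD('a) CARD('n) ` {..<Suc CARD('n)}"
    unfolding top[symmetric] by (rule spectrum(2))
qed

theorem theorem4p2p2:
  fixes G :: "('a::{finite,field}^('n::finite + 'n)^('n + 'n)) set"
    and chi :: "'a^('n + 'n)^('n + 'n) \<Rightarrow> complex"
    and \<alpha> \<beta> :: "'a \<Rightarrow> complex"
    and n q :: nat
  assumes "n = CARD('n)" and "q = CARD('a)"
    and "odd q" and "\<not> 3 dvd q"
    and "G \<in> {GL, SL}"
    and "is_character (parabolic G) (**) chi"
    and "is_character (UNIV - {0}) (*) \<alpha>"
    and "is_character (UNIV - {0}) (*) \<beta>"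
    and "\<forall>p\<in>parabolic G. chi p = \<alpha> (m_char p) * \<beta> (chi_det p)"
    and "\<forall>x\<in>UNIV - {0}. \<beta> x = 1"
  shows "(\<forall>p\<in>parabolic G. twist_J chi p = chi p)
    \<and> diagonalizable_on (Ind G chi) (intertwiner G)
    \<and> eigenvalues_on (Ind G chi) (intertwiner G)
      = {(- 1) ^ (n - i) * of_nat q ^ ((n choose 2) + ((i + 1) choose 2)) | i. 0 \<le> i \<and> i \<le> n}"
proof -
  interpret siegel_series G \<alpha>
    using assms(5,7) by unfold_locales
  have blocks: "upper_left (block_mat A B C D) = A" "lower_right (block_mat A B C D) = D"
    for A B C D :: "'a^'n^'n"
    by (simp_all add: upper_left_def lower_right_def vec_eq_iff)
  have chi: "chi p = \<alpha> (det p)" if p: "p \<in> parabolic G" for p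
  proof -
    obtain A B D where pG: "p \<in> G" and p_eq: "p = block_mat A B 0 D"
      using p by (auto simp: parabolic_def)
    have det: "det p = det A * det D" unfolding p_eq by (rule det_block_triangular)
    then have "det D \<noteq> 0" using G_det[OF pG] by auto
    then have "\<beta> (chi_det p) = 1" using assms(10) by (simp add: chi_det_def p_eq blocks)
    moreover have "m_char p = det p" by (simp add: m_char_def p_eq blocks det_mul det[unfolded p_eq])
    ultimately show ?thesis using assms(9) p by simp
  qed
  have "twist_J chi p = chi p" if p: "p \<in> parabolic G" for p
  proof -
    obtain A B D where pG: "p \<in> G" and p_eq: "p = block_mat A B 0 D"
      using p by (auto simp: parabolic_def)
    have det: "det (block_mat D 0 0 A) = det p"
      unfolding p_eq det_block_triangular by (rule mult.commute)
    then have "block_mat D 0 0 A \<in> G"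
      using pG assms(5) by (auto simp: GL_def SL_def invertible_det_nz)
    then have "block_mat D 0 0 A \<in> parabolic G" by (auto simp: parabolic_def)
    then have "chi (block_mat D 0 0 A) = chi p" using chi p det by simp
    then show ?thesis by (simp add: twist_J_def p_eq blocks)
  qed
  then show ?thesis
    using intertwiner_spectrum[of chi, OF chi] unfolding eigval_image assms(1,2) by blast
qed

end
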